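(* Let $n\ge 2$ and $2\le k\le n$ be integers, and let $\Omega\subset\mathbb{R}^n$ be an open ball with center $x_0$. Let $\theta$ be the unique solution in $\Phi_0^k(\Omega)$ of $$S_k(D^2\theta)=-\frac{1}{k-1}\,\theta\ \text{ in }\Omega,\qquad \theta<0\ \text{ in }\Omega,\qquad \theta=0\ \text{ on }\partial\Omega.$$ Let $u(t,x)$ be a solution of the problem $$\begin{cases} u_t=S_k(D^2u) & \text{in } (0,\infty)\times\Omega,\\ u(t,\cdot)\ \text{is } k\text{-admissible for each } t\ge 0,\\ u(t,x)=0 & \text{on } [0,\infty)\times\partial\Omega.\end{cases}$$ Then $\theta$ is radially symmetric about $x_0$, i.e. $\theta(x)=\theta(|x-x_0|)$ (with the usual abuse of notation), and $$\left|(1+t)^{1/(k-1)}u(t,x)-\theta(|x-x_0|)\right|\longrightarrow 0\quad\text{as } t\to\infty,\ \text{uniformly on } \overline\Omega.$$ In other words, $u(t,x)$ asymptotically becomes radially symmetric regardless of its initial shape.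
   Context: For a $C^2$ function $u$ on a domain in $\mathbb{R}^n$, $D^2u$ denotes its Hessian matrix (with respect to $x$) and the $k$-Hessian operator is $S_k(D^2u)=\sigma_k(\Lambda(D^2u))=\sum_{1\le i_1<\dots<i_k\le n}\lambda_{i_1}\cdots\lambda_{i_k}$, where $\Lambda(D^2u)=(\lambda_1,\dots,\lambda_n)$ are the eigenvalues of $D^2u$ and $\sigma_k$ is the $k$-th elementary symmetric function. $\Phi^k(\Omega)=\{u\in C^2(\Omega)\cap C(\overline\Omega): \sigma_j(\Lambda(D^2u))>0 \text{ in }\Omega,\ j=1,\dots,k\}$; its elements are called $k$-admissible on $\Omega$. $\Phi_0^k(\Omega)$ is the set of functions in $\Phi^k(\Omega)$ vanishing on $\partial\Omega$. Solutions $u(t,x)$, $t\in[0,\infty)$, $x\in\overline\Omega$, are understood in the classical sense. The existence and uniqueness of $\theta$ is known for such $\Omega$. *)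

theory Defs
  imports "HOL-Analysis.Analysis" "HOL-Computational_Algebra.Polynomial"
begin

definition gradient :: "(real ^ 'n \<Rightarrow> real) \<Rightarrow> real ^ 'n \<Rightarrow> real ^ 'n" where
  "gradient f x = (\<chi> i. frechet_derivative f (at x) (axis i 1))"

definition hessian :: "(real ^ 'n \<Rightarrow> real) \<Rightarrow> real ^ 'n \<Rightarrow> real ^ 'n ^ 'n" where
  "hessian f x = matrix (frechet_derivative (gradient f) (at x))"

text \<open>To be used for open \<open>S\<close> only, where the derivatives at a point of \<open>S\<close> depend only on
  the values of \<open>f\<close> on \<open>S\<close>.\<close>

definition C2_on :: "(real ^ 'n \<Rightarrow> real) \<Rightarrow> (real ^ 'n) set \<Rightarrow> bool" where
  "C2_on f S \<longleftrightarrow> f differentiable_on S \<and> gradient f differentiable_on S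
     \<and> continuous_on S (hessian f)"

definition charpoly :: "real ^ 'n ^ 'n \<Rightarrow> real poly" where
  "charpoly A = det (mat [:0, 1:] - map_matrix (\<lambda>a. [:a:]) A)"

text \<open>The real eigenvalues in increasing order, each repeated according to its algebraic
  multiplicity. For a symmetric matrix, such as the Hessian of a \<open>C\<^sup>2\<close> function, these are all
  \<open>n\<close> eigenvalues.\<close>

definition eigenvalues :: "real ^ 'n ^ 'n \<Rightarrow> real list" where
  "eigenvalues A = sorted_list_of_multiset (proots (charpoly A))"

definition elem_sym :: "nat \<Rightarrow> real list \<Rightarrow> real" where
  "elem_sym k ls = (\<Sum>I | I \<subseteq> {..<length ls} \<and> card I = k. \<Prod>i\<in>I. ls ! i)"

definition hessian_op :: "nat \<Rightarrow> (real ^ 'n \<Rightarrow> real) \<Rightarrow> real ^ 'n \<Rightarrow> real" where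
  "hessian_op k f x = elem_sym k (eigenvalues (hessian f x))"

definition admissible :: "nat \<Rightarrow> (real ^ 'n) set \<Rightarrow> (real ^ 'n \<Rightarrow> real) set" where
  "admissible k \<Omega> = {f. C2_on f \<Omega> \<and> continuous_on (closure \<Omega>) f
     \<and> (\<forall>j\<in>{1..k}. \<forall>x\<in>\<Omega>. hessian_op j f x > 0)}"

definition admissible0 :: "nat \<Rightarrow> (real ^ 'n) set \<Rightarrow> (real ^ 'n \<Rightarrow> real) set" where
  "admissible0 k \<Omega> = {f \<in> admissible k \<Omega>. \<forall>x\<in>frontier \<Omega>. f x = 0}"

definition solves_stationary :: "nat \<Rightarrow> (real ^ 'n) set \<Rightarrow> (real ^ 'n \<Rightarrow> real) \<Rightarrow> bool" where
  "solves_stationary k \<Omega> \<theta> \<longleftrightarrow> \<theta> \<in> admissible0 k \<Omega>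
     \<and> (\<forall>x\<in>\<Omega>. hessian_op k \<theta> x = - (1 / (real k - 1)) * \<theta> x)
     \<and> (\<forall>x\<in>\<Omega>. \<theta> x < 0)"

text \<open>Classical solutions: \<open>u\<close> is continuous up to the parabolic boundary, \<open>u\<^sub>t\<close> exists and
  every slice \<open>u(t,\<cdot>)\<close> is of class \<open>C\<^sup>2\<close> (by admissibility), and the equation holds pointwise.
  Joint continuity of \<open>u\<^sub>t\<close> and \<open>D\<^sup>2u\<close> in \<open>(t,x)\<close> is not required, so that solutions in the class
  \<open>C\<^sup>1\<^sup>,\<^sup>2\<close> are included.\<close>

definition solves_evolution ::
  "nat \<Rightarrow> (real ^ 'n) set \<Rightarrow> (real \<Rightarrow> real ^ 'n \<Rightarrow> real) \<Rightarrow> bool" where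
  "solves_evolution k \<Omega> u \<longleftrightarrow>
     continuous_on ({0..} \<times> closure \<Omega>) (\<lambda>(t, x). u t x)
     \<and> (\<forall>t>0. \<forall>x\<in>\<Omega>. ((\<lambda>s. u s x) has_real_derivative hessian_op k (u t) x) (at t))
     \<and> (\<forall>t\<ge>0. u t \<in> admissible k \<Omega>)
     \<and> (\<forall>t\<ge>0. \<forall>x\<in>frontier \<Omega>. u t x = 0)"

end

theory Submission
  imports Defs
begin

text \<open>The two bounds are asymmetric because the definitions give no slope at the boundary: the
  quotient of \<open>u 0\<close> and \<open>\<theta>\<close> has no evident bound there in either
  direction. From below, a shift by \<epsilon> cures this at the cost of a time shift T > 0 that may
  shrink with \<epsilon>, and the final bound drops T. From above, the same device would give no
  control of T from growing without bound as \<epsilon> tends to 0, and the bound could become empty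
  in the limit; the smaller ball makes T finite by compactness instead. The price is a profile on
  that ball. Dilating by s and multiplying by c reproduces the equation when (c s^(-2))^k = c, and
  this is the origin of the exponent 2k/(k-1).

  The time derivative and the slice Hessians are only known pointwise, so comparison has to be read
  off at a single maximum point. Hessians are therefore handled as a relation at a point, and their
  symmetry is proved in that generality.\<close>

text \<open>With \<open>a = 1/(k-1)\<close>, the functions \<open>(T + t)\<^bsup>-a\<^esup> \<theta>(x)\<close> are self-similar solutions. The
  comparison principle, applied after a shift by \<open>\<epsilon>\<close>, gives the universal lower bound
  \<open>u \<ge> t\<^bsup>-a\<^esup> \<theta>\<close>. For an upper bound, \<open>u\<close> is compared on a concentric smaller ball with the
  self-similar solution built from the dilated profile \<open>s\<^bsup>2k/(k-1)\<^esup> \<theta>(x\<^sub>0 + (x - x\<^sub>0)/s)\<close>; since \<open>u\<close>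
  is negative on that closed ball no barrier at the boundary is needed, and letting \<open>t \<rightarrow> \<infinity>\<close> and then
  \<open>s \<rightarrow> 1\<close> yields convergence. Convergence implies uniqueness of the profile and
  hence its radial symmetry.

  The comparison principle needs \<open>S\<^sub>k(A) \<le> S\<^sub>k(B)\<close> for \<open>A \<le> B\<close> with \<open>A\<close> in the Garding cone. By
  Weyl's principle the eigenvalues are ordered, and \<open>\<sigma>\<^sub>k\<close> is monotone in each variable on the cone
  by Newton's inequality.\<close>

section \<open>Elementary symmetric functions\<close>

text \<open>The generating function, a product of factors 1 + x t, whose coefficients are the
  \<sigma>_j. On multisets, adding an entry multiplies by one linear factor, and real-rootedness is
  visible.\<close>

definition gen_poly :: "real multiset \<Rightarrow> real poly" where
  "gen_poly M = (\<Prod>x\<in>#M. [:1, x:])"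

definition esym :: "real multiset \<Rightarrow> nat \<Rightarrow> real" where
  "esym M j = coeff (gen_poly M) j"

lemma esym_0 [simp]: "esym M 0 = 1"
  unfolding esym_def gen_poly_def by (induction M) (auto simp: coeff_mult)

lemma esym_add_Suc: "esym (add_mset x M) (Suc j) = esym M (Suc j) + x * esym M j"
  by (simp add: esym_def gen_poly_def)

text \<open>Expand the product over index subsets: X contributes a monomial of degree
  \<open>card X\<close>.\<close>

lemma elem_sym_eq_esym: "elem_sym k ls = esym (mset ls) k"
proof -
  have "gen_poly (mset ls) = (\<Prod>i<length ls. monom (ls ! i) 1 + 1)"
    by (simp add: gen_poly_def prod_mset_prod_list prod.list_conv_set_nth monom_altdef
        atLeast0LessThan add.commute flip: mset_map) (simp add: one_pCons)
  also have "\<dots> = (\<Sum>X\<in>Pow {..<length ls}. \<Prod>i\<in>X. monom (ls ! i) 1)"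
    by (subst prod_add) auto
  also have "\<dots> = (\<Sum>X\<in>Pow {..<length ls}. monom (\<Prod>i\<in>X. ls ! i) (card X))"
  proof (intro sum.cong refl)
    fix X show "(\<Prod>i\<in>X. monom (ls ! i) 1) = monom (\<Prod>i\<in>X. ls ! i) (card X)"
      by (induction X rule: infinite_finite_induct) (auto simp: mult_monom monom_0)
  qed
  finally have "esym (mset ls) k
      = (\<Sum>X\<in>Pow {..<length ls}. if card X = k then \<Prod>i\<in>X. ls ! i else 0)"
    by (simp add: esym_def coeff_sum)
  also have "\<dots> = elem_sym k ls"
    unfolding elem_sym_def
    by (subst sum.inter_filter[symmetric]) (auto intro!: sum.cong)
  finally show ?thesis ..
qed

section \<open>Real-rooted polynomials and Newton's inequality\<close>

definition real_rooted :: "real poly \<Rightarrow> bool" where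
  "real_rooted p \<longleftrightarrow> p \<noteq> 0 \<and> size (proots p) = degree p"

lemma real_rooted_mult_iff:
  assumes "p \<noteq> 0" "q \<noteq> 0"
  shows "real_rooted (p * q) \<longleftrightarrow> real_rooted p \<and> real_rooted q"
  using size_proots_le[of p] size_proots_le[of q] assms
  by (auto simp: real_rooted_def proots_mult degree_mult_eq)

lemma real_rooted_gen_poly: "real_rooted (gen_poly M)"
proof (induction M)
  case empty
  then show ?case by (simp add: gen_poly_def real_rooted_def)
next
  case (add x M)
  \<comment> \<open>For x = 0 the factor is the constant 1; otherwise its only root is -1/x.\<close>
  have lin: "real_rooted [:1, x:]"
  proof (cases "x = 0")
    case False
    then have eq: "[:1, x:] = smult x [:1 / x, 1:]" by simp
    show ?thesis
      unfolding real_rooted_def eq using False by (subst proots_smult) auto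
  qed (simp add: real_rooted_def)
  then have "[:1, x:] \<noteq> 0" "gen_poly M \<noteq> 0"
    using add by (auto simp: real_rooted_def)
  then show ?case
    using lin add real_rooted_mult_iff[of "[:1, x:]" "gen_poly M"] by (simp add: gen_poly_def)
qed

text \<open>Where p is nonzero this is concavity of log |p|, whose second derivative is minus the
  sum of 1/(x - a)^2 over the roots a. Splitting off one linear factor at a time also covers the
  case that x is a root.\<close>

lemma laguerre_inequality:
  assumes "real_rooted p"
  shows "poly p x * poly (pderiv (pderiv p)) x \<le> (poly (pderiv p) x)\<^sup>2"
  using assms
proof (induction "degree p" arbitrary: p)
  case 0
  then obtain c where "p = [:c:]" using degree_eq_zeroE by metis
  then show ?case by simp
next
  case (Suc n)
  then have "proots p \<noteq> {#}" by (auto simp: real_rooted_def)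
  then obtain a where "a \<in># proots p" by blast
  then have "poly p a = 0" using Suc.prems by (auto simp: real_rooted_def)
  then obtain q where p: "p = [:- a, 1:] * q"
    by (meson dvdE poly_eq_0_iff_dvd)
  then have q0: "q \<noteq> 0" using Suc.prems by (auto simp: real_rooted_def)
  have "degree p = Suc (degree q)" unfolding p using q0 by (subst degree_mult_eq) auto
  then have "n = degree q" using Suc.hyps(2) by simp
  moreover have "real_rooted q"
    using Suc.prems q0 real_rooted_mult_iff[of "[:-a,1:]" q] unfolding p by auto
  ultimately have IH: "poly q x * poly (pderiv (pderiv q)) x \<le> (poly (pderiv q) x)\<^sup>2"
    using Suc.hyps(1) by blast
  define f f1 f2 where "f = poly q x" "f1 = poly (pderiv q) x" "f2 = poly (pderiv (pderiv q)) x"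
  have e0: "poly p x = (x - a) * f"
    by (simp add: p f_f1_f2_def algebra_simps)
  have e1: "poly (pderiv p) x = f + (x - a) * f1"
    unfolding p pderiv_mult by (simp add: f_f1_f2_def pderiv_pCons algebra_simps)
  have e2: "poly (pderiv (pderiv p)) x = 2 * f1 + (x - a) * f2"
    unfolding p pderiv_mult pderiv_add by (simp add: f_f1_f2_def pderiv_pCons pderiv_add pderiv_mult algebra_simps)
  \<comment> \<open>The defect for p is f^2 plus (x - a)^2 times the defect for the cofactor
    q.\<close>
  have "(f + (x - a) * f1)\<^sup>2 - (x - a) * f * (2 * f1 + (x - a) * f2)
      = f\<^sup>2 + (x - a)\<^sup>2 * (f1\<^sup>2 - f * f2)"
    by (simp add: power2_eq_square algebra_simps)
  also have "\<dots> \<ge> 0"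
    using IH unfolding f_f1_f2_def[symmetric] by (simp add: mult_nonneg_nonneg)
  finally show ?case unfolding e0 e1 e2 by simp
qed

text \<open>By Rolle's theorem the derivative has a root in each gap between adjacent roots; with the
  roots it inherits from multiple roots this accounts for the full degree.\<close>

lemma real_rooted_pderiv:
  assumes "real_rooted p" "degree p > 0"
  shows "real_rooted (pderiv p)"
proof -
  have p0: "p \<noteq> 0" and sz: "size (proots p) = degree p"
    using assms by (auto simp: real_rooted_def)
  have d0: "pderiv p \<noteq> 0" using assms(2) pderiv_eq_0_iff[of p] by auto
  define R where "R = {x. poly p x = 0}"
  have finR: "finite R" using p0 poly_roots_finite unfolding R_def by blast
  have "proots p \<noteq> {#}" using sz assms(2) by auto
  then have neR: "R \<noteq> {}" using p0 unfolding R_def by (metis set_count_proots set_mset_eq_empty_iff)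
  define nx where "nx r = Min {s \<in> R. r < s}" for r
  define S where "S = R - {Max R}"
  have nx: "nx r \<in> R" "r < nx r" "\<And>s. s \<in> R \<Longrightarrow> r < s \<Longrightarrow> nx r \<le> s" if "r \<in> S" for r
  proof -
    have "Max R \<in> {s \<in> R. r < s}"
      using that finR neR unfolding S_def by (auto simp: less_le)
    then have "nx r \<in> {s \<in> R. r < s}" unfolding nx_def using finR by (intro Min_in) auto
    then show "nx r \<in> R" "r < nx r" by auto
    show "nx r \<le> s" if "s \<in> R" "r < s" for s unfolding nx_def using finR that by auto
  qed
  have "\<exists>c. r < c \<and> c < nx r \<and> poly (pderiv p) c = 0" if "r \<in> S" for r
  proof -
    have "\<exists>c. r < c \<and> c < nx r \<and> poly p (nx r) - poly p r = (nx r - r) * poly (pderiv p) c"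
      using nx[OF that] by (intro poly_MVT) auto
    then show ?thesis using nx[OF that] that by (auto simp: R_def S_def)
  qed
  then obtain c where c: "\<And>r. r \<in> S \<Longrightarrow> r < c r \<and> c r < nx r \<and> poly (pderiv p) (c r) = 0"
    by metis
  have "strict_mono_on S c"
  proof (rule strict_mono_onI)
    fix r s assume rs: "r \<in> S" "s \<in> S" "r < s"
    have "nx r \<le> s" using nx(3)[OF rs(1)] rs by (auto simp: S_def)
    then show "c r < c s" using c[OF rs(1)] c[OF rs(2)] by linarith
  qed
  then have injc: "inj_on c S" by (rule strict_mono_on_imp_inj_on)
  have disj: "R \<inter> c ` S = {}"
  proof -
    have False if "r \<in> S" "c r \<in> R" for r
      using nx(3)[OF that(1) that(2)] c[OF that(1)] by auto
    then show ?thesis by blast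
  qed
  have cardS: "card S = card R - 1" unfolding S_def using finR neR by simp
  have cardR: "card R > 0" using finR neR card_gt_0_iff by blast
  \<comment> \<open>Differentiation lowers the order at each of the \<open>card R\<close> roots by
    one, and Rolle returns \<open>card R - 1\<close> new roots: the net loss is one, as for the
    degree.\<close>
  have "degree p = (\<Sum>r\<in>R. order r p)"
    unfolding sz[symmetric] size_multiset_overloaded_eq using p0 by (simp add: R_def)
  also have "\<dots> = (\<Sum>r\<in>R. Suc (order r (pderiv p)))"
    using p0 d0 by (intro sum.cong refl order_pderiv) (auto simp: R_def order_root)
  also have "\<dots> = (\<Sum>r\<in>R. order r (pderiv p)) + card S + 1"
    using cardS cardR by (simp add: sum_Suc)
  also have "card S = (\<Sum>r\<in>c ` S. 1)"
    using injc by (simp add: card_image)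
  also have "(\<Sum>r\<in>c ` S. 1) \<le> (\<Sum>r\<in>c ` S. order r (pderiv p))"
    using c d0 by (intro sum_mono) (auto simp: Suc_le_eq order_gt_0_iff)
  also have "(\<Sum>r\<in>R. order r (pderiv p)) + (\<Sum>r\<in>c ` S. order r (pderiv p)) + 1
      = (\<Sum>r\<in>R \<union> c ` S. order r (pderiv p)) + 1"
    using disj finR by (subst sum.union_disjoint) (auto simp: S_def)
  also have "(\<Sum>r\<in>R \<union> c ` S. order r (pderiv p)) \<le> size (proots (pderiv p))"
  proof -
    have "(\<Sum>r\<in>R \<union> c ` S. order r (pderiv p)) = (\<Sum>r\<in>(R \<union> c ` S) \<inter> set_mset (proots (pderiv p)). order r (pderiv p))"
      using finR d0 by (intro sum.mono_neutral_right) (auto simp: S_def order_root)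
    also have "\<dots> \<le> (\<Sum>r\<in>set_mset (proots (pderiv p)). order r (pderiv p))"
      by (intro sum_mono2) auto
    also have "\<dots> = size (proots (pderiv p))"
      unfolding size_multiset_overloaded_eq using d0 by simp
    finally show ?thesis .
  qed
  finally have "degree (pderiv p) \<le> size (proots (pderiv p))"
    by (simp add: degree_pderiv)
  then show ?thesis
    using size_proots_le[of "pderiv p"] d0 by (simp add: real_rooted_def)
qed

lemma higher_pderiv_real_rooted:
  assumes "real_rooted p"
  shows "(pderiv ^^ j) p = 0 \<or> real_rooted ((pderiv ^^ j) p)"
proof (induction j)
  case (Suc j)
  show ?case
  proof (cases "degree ((pderiv ^^ j) p) > 0")
    case True
    then show ?thesis using Suc by (auto intro: real_rooted_pderiv)
  next
    case False
    then show ?thesis by (simp add: pderiv_eq_0_iff)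
  qed
qed (use assms in auto)

text \<open>Laguerre's inequality at 0 for the j-th derivative of the generating function, whose
  lowest coefficients are \<sigma>_j, \<sigma>_(j+1), \<sigma>_(j+2) up to factorial
  factors.\<close>

lemma newton_inequality: "esym M j * esym M (Suc (Suc j)) \<le> (esym M (Suc j))\<^sup>2"
proof -
  define q where "q = (pderiv ^^ j) (gen_poly M)"
  have co: "coeff q i = pochhammer (real (Suc i)) j * esym M (i + j)" for i
    unfolding q_def esym_def by (simp add: coeff_higher_pderiv)
  have "poly q 0 * poly (pderiv (pderiv q)) 0 \<le> (poly (pderiv q) 0)\<^sup>2"
    using higher_pderiv_real_rooted[OF real_rooted_gen_poly[of M], of j]
    unfolding q_def[symmetric] by (auto intro: laguerre_inequality)
  then have L: "coeff q 0 * (2 * coeff q 2) \<le> (coeff q 1)\<^sup>2"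
    by (simp add: poly_0_coeff_0 coeff_pderiv numeral_2_eq_2)
  define F :: real where "F = fact j"
  have F: "F > 0" by (simp add: F_def)
  have c0: "coeff q 0 = F * esym M j"
    unfolding co F_def by (simp add: pochhammer_fact)
  have p1: "pochhammer (1::real) (Suc j) = fact (Suc j)" "pochhammer (1::real) (Suc (Suc j)) = fact (Suc (Suc j))"
    by (simp_all only: pochhammer_fact)
  have "pochhammer (2::real) j = fact (Suc j)"
    using p1(1) unfolding pochhammer_rec by simp
  then have c1: "coeff q 1 = (1 + real j) * F * esym M (Suc j)"
    unfolding co F_def by simp
  have p3: "2 * pochhammer (3::real) j = fact (Suc (Suc j))"
    using p1(2) unfolding pochhammer_rec by simp
  have "2 * coeff q 2 = (2 * pochhammer (3::real) j) * esym M (Suc (Suc j))"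
    unfolding co by simp
  also have "\<dots> = (2 + real j) * (1 + real j) * F * esym M (Suc (Suc j))"
    unfolding p3 F_def by (simp add: algebra_simps)
  finally have c2: "2 * coeff q 2 = (2 + real j) * (1 + real j) * F * esym M (Suc (Suc j))" .
  define e0 e1 e2 where "e0 = esym M j" "e1 = esym M (Suc j)" "e2 = esym M (Suc (Suc j))"
  have "((1 + real j) * F\<^sup>2) * ((2 + real j) * (e0 * e2)) \<le> ((1 + real j) * F\<^sup>2) * ((1 + real j) * e1\<^sup>2)"
    using L unfolding c0 c1 c2 e0_e1_e2_def by (simp add: power2_eq_square algebra_simps)
  then have "(2 + real j) * (e0 * e2) \<le> (1 + real j) * e1\<^sup>2"
    using F by (subst (asm) mult_le_cancel_left_pos) (auto intro!: mult_pos_pos)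
  \<comment> \<open>The gain (j+1)/(j+2) is given away: the sign argument on the cone works with the
    constant 1.\<close>
  also have "\<dots> \<le> (2 + real j) * e1\<^sup>2" by (intro mult_right_mono) auto
  finally show ?thesis unfolding e0_e1_e2_def by (subst (asm) mult_le_cancel_left_pos) auto
qed

section \<open>The Garding cone and monotonicity on it\<close>

definition garding_cone :: "nat \<Rightarrow> real multiset \<Rightarrow> bool" where
  "garding_cone k M \<longleftrightarrow> (\<forall>j\<in>{1..k}. esym M j > 0)"

lemma garding_cone_esym_pos: "garding_cone k M \<Longrightarrow> j \<le> k \<Longrightarrow> esym M j > 0"
  by (cases "j = 0") (auto simp: garding_cone_def)

text \<open>Were the highest of the symmetric functions of \<open>M\<close> nonpositive, positivity of the two top ones
  of \<open>add_mset x M\<close> would violate Newton's inequality.\<close>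

lemma garding_cone_remove:
  assumes "garding_cone (Suc k) (add_mset x M)"
  shows "garding_cone k M"
  using assms
proof (induction k)
  case (Suc k)
  then have IH: "garding_cone k M" by (simp add: garding_cone_def)
  define a b c where "a = esym M k" "b = esym M (Suc k)" "c = esym M (Suc (Suc k))"
  have a: "a > 0" using garding_cone_esym_pos[OF IH] by (simp add: a_b_c_def)
  have 1: "b + x * a > 0" and 2: "c + x * b > 0"
    using garding_cone_esym_pos[OF Suc.prems, of "Suc k"] garding_cone_esym_pos[OF Suc.prems, of "Suc (Suc k)"]
    by (simp_all add: esym_add_Suc a_b_c_def)
  have N: "a * c \<le> b\<^sup>2" using newton_inequality unfolding a_b_c_def .
  have "b > 0"
  proof (rule ccontr)
    assume "\<not> b > 0"
    then have b: "b \<le> 0" by simp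
    have "a * c > a * (- x * b)" using 2 a by (intro mult_strict_left_mono) auto
    moreover have "- x * a * b \<ge> b * b"
      using mult_right_mono_neg[of "-b" "x * a" b] 1 b by (simp add: algebra_simps)
    ultimately show False using N by (simp add: power2_eq_square algebra_simps)
  qed
  then have "esym M j > 0" if "j \<le> Suc k" for j
    using that garding_cone_esym_pos[OF IH, of j] by (cases "j = Suc k") (auto simp: a_b_c_def)
  then show ?case by (auto simp: garding_cone_def)
qed (simp add: garding_cone_def)

text \<open>\<sigma>_j is affine in the single entry x, with slope \<sigma>_(j-1) of the remaining
  entries; this is positive because they lie in the next lower cone.\<close>

lemma garding_cone_replace:
  assumes "garding_cone k (add_mset x M)" "x \<le> y"
  shows "garding_cone k (add_mset y M) \<and> (\<forall>j\<le>k. esym (add_mset x M) j \<le> esym (add_mset y M) j)"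
proof -
  have le: "esym (add_mset x M) j \<le> esym (add_mset y M) j" if jk: "j \<le> k" for j
  proof (cases j)
    case (Suc i)
    then obtain l where k: "k = Suc l" using jk by (cases k) auto
    have "garding_cone l M" using garding_cone_remove assms(1) unfolding k .
    then have "esym M i > 0" using garding_cone_esym_pos jk k Suc by auto
    then show ?thesis using assms(2) by (simp add: Suc esym_add_Suc mult_right_mono)
  qed simp
  then show ?thesis using assms(1) by (force simp: garding_cone_def)
qed

text \<open>Entries are raised one at a time, with K carrying those held fixed meanwhile. Cone
  membership is part of the induction, since the next replacement starts from the new
  multiset.\<close>

lemma esym_mono_list_all2:
  assumes "list_all2 (\<le>) ls ms" "garding_cone k (mset ls + K)" "j \<le> k"
  shows "esym (mset ls + K) j \<le> esym (mset ms + K) j"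
proof -
  have "garding_cone k (mset ms + K) \<and> (\<forall>j\<le>k. esym (mset ls + K) j \<le> esym (mset ms + K) j)"
    using assms(1,2)
  proof (induction arbitrary: K rule: list_all2_induct)
    case (Cons x xs y ys)
    have g: "garding_cone k (mset xs + add_mset x K)" using Cons.prems by simp
    have h: "garding_cone k (mset ys + add_mset x K)"
       "\<forall>j\<le>k. esym (mset xs + add_mset x K) j \<le> esym (mset ys + add_mset x K) j"
      using Cons.IH[OF g] by auto
    have "garding_cone k (add_mset y (mset ys + K)) \<and> (\<forall>j\<le>k. esym (add_mset x (mset ys + K)) j \<le> esym (add_mset y (mset ys + K)) j)"
      using h(1) Cons.hyps by (intro garding_cone_replace) auto
    then show ?case using h(2) by (auto intro: order_trans)
  qed simp
  then show "esym (mset ls + K) j \<le> esym (mset ms + K) j"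
    using assms(3) by auto
qed

section \<open>Eigenvalues of symmetric matrices\<close>

text \<open>A maximiser v of the quadratic form on the unit sphere of S is an eigenvector: otherwise
  moving v towards the residual \<open>f v - c v\<close>, which stays in S, would increase the
  Rayleigh quotient.\<close>

lemma selfadjoint_eigenvector_in_subspace:
  fixes f :: "'a::euclidean_space \<Rightarrow> 'a"
  assumes f: "linear f" and sa: "\<And>x y. f x \<bullet> y = x \<bullet> f y"
    and S: "subspace S" "f ` S \<subseteq> S" "S \<noteq> {0}"
  shows "\<exists>v\<in>S. norm v = 1 \<and> (\<exists>c. f v = c *\<^sub>R v)"
proof -
  obtain s where s: "s \<in> S" "s \<noteq> 0" using S subspace_0 by blast
  have "compact (S \<inter> sphere 0 1)"
    using S(1) closed_subspace by (metis closed_Int_compact compact_sphere)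
  moreover have "s /\<^sub>R norm s \<in> S \<inter> sphere 0 1"
    using s S(1) by (simp add: subspace_scale)
  moreover have "continuous_on (S \<inter> sphere 0 1) (\<lambda>x. x \<bullet> f x)"
    using f by (intro continuous_intros linear_continuous_on linear_linear[THEN iffD1])
      (simp_all add: linear_conv_bounded_linear)
  ultimately obtain v where v: "v \<in> S \<inter> sphere 0 1"
    and max: "\<And>y. y \<in> S \<inter> sphere 0 1 \<Longrightarrow> y \<bullet> f y \<le> v \<bullet> f v"
    by (metis continuous_attains_sup empty_iff)
  define c where "c = v \<bullet> f v"
  have le: "x \<bullet> f x \<le> c * (x \<bullet> x)" if "x \<in> S" for x
  proof (cases "x = 0")
    case False
    have "(x /\<^sub>R norm x) \<bullet> f (x /\<^sub>R norm x) \<le> c"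
      unfolding c_def using that S(1) False by (intro max) (simp add: subspace_scale)
    then have "(x \<bullet> f x) / (norm x)\<^sup>2 \<le> c"
      by (simp add: linear_scale[OF f] power2_eq_square divide_inverse mult_ac)
    then show ?thesis using False
      by (simp add: divide_le_eq power2_norm_eq_inner split: if_splits)
  qed (simp add: linear_0[OF f])
  define w where "w = f v - c *\<^sub>R v"
  have wS: "w \<in> S" unfolding w_def using S v by (auto intro!: subspace_diff subspace_scale)
  have vv: "v \<bullet> v = 1" using v by (simp add: norm_eq_1)
  define K where "K = w \<bullet> f w - c * (w \<bullet> w)"
  have ineq: "2 * t * (w \<bullet> w) + t\<^sup>2 * K \<le> 0" for t
  proof -
    have "(v + t *\<^sub>R w) \<bullet> f (v + t *\<^sub>R w) \<le> c * ((v + t *\<^sub>R w) \<bullet> (v + t *\<^sub>R w))"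
      using v wS S(1) by (intro le subspace_add subspace_scale) auto
    moreover have vw: "w \<bullet> v = 0"
      by (simp add: w_def inner_diff_left vv c_def inner_commute[of "f v"])
    moreover have "w \<bullet> w = w \<bullet> f v"
      using vw w_def by (metis diff_zero inner_diff_right inner_scaleR_right mult_zero_right)
    moreover have "v \<bullet> f w = w \<bullet> f v" by (metis inner_commute sa)
    ultimately show ?thesis
      by (simp add: linear_add[OF f] linear_scale[OF f] inner_add_left inner_add_right vv c_def[symmetric]
          K_def power2_eq_square inner_commute algebra_simps)
  qed
  have "w \<bullet> w \<le> 0"
  proof (rule ccontr)
    assume "\<not> w \<bullet> w \<le> 0"
    then have b: "w \<bullet> w > 0" by linarith
    \<comment> \<open>So small that t |K| \<le> |w|^2, which lets the term linear in t dominate in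
      \<open>ineq\<close>.\<close>
    define t where "t = (w \<bullet> w) / (\<bar>K\<bar> + 1)"
    have t: "t > 0" unfolding t_def using b by (intro divide_pos_pos) auto
    have "t * \<bar>K\<bar> \<le> t * (\<bar>K\<bar> + 1)" using t by (intro mult_left_mono) auto
    also have "\<dots> = w \<bullet> w" unfolding t_def using abs_ge_zero[of K] by (simp add: nonzero_divide_eq_eq)
    finally have "t * (t * \<bar>K\<bar>) \<le> t * (w \<bullet> w)" using t by (intro mult_left_mono) auto
    moreover have "t * (t * K) \<ge> - (t * (t * \<bar>K\<bar>))"
    proof -
      have "t * (t * K) \<ge> t * (t * (- \<bar>K\<bar>))" using t by (intro mult_left_mono) auto
      then show ?thesis by simp
    qed
    moreover have "t * (w \<bullet> w) > 0" using t b by simp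
    ultimately show False using ineq[of t] by (simp add: power2_eq_square mult.assoc)
  qed
  then have "w = 0" by (metis inner_eq_zero_iff inner_ge_zero order_antisym)
  then show ?thesis using v by (auto simp: w_def)
qed

text \<open>Induction on the dimension: by self-adjointness, the orthogonal complement in S of an
  eigenvector is again invariant.\<close>

lemma selfadjoint_eigenbasis:
  fixes f :: "'a::euclidean_space \<Rightarrow> 'a"
  assumes f: "linear f" and sa: "\<And>x y. f x \<bullet> y = x \<bullet> f y"
    and S: "subspace S" "f ` S \<subseteq> S"
  shows "\<exists>B. pairwise orthogonal B \<and> (\<forall>b\<in>B. norm b = 1 \<and> (\<exists>c. f b = c *\<^sub>R b)) \<and> span B = S"
  using S
proof (induction "dim S" arbitrary: S rule: less_induct)
  case less
  show ?case
  proof (cases "S = {0}")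
    case True
    then show ?thesis by (intro exI[of _ "{}"]) auto
  next
    case False
    then obtain v c where v: "v \<in> S" "norm v = 1" "f v = c *\<^sub>R v"
      using selfadjoint_eigenvector_in_subspace[OF f sa less.prems] by blast
    have vv: "v \<bullet> v = 1" using v by (simp add: norm_eq_1)
    define T where "T = S \<inter> {x. v \<bullet> x = 0}"
    have T: "subspace T"
      unfolding T_def by (intro subspace_inter less.prems subspace_hyperplane)
    have fT: "f ` T \<subseteq> T"
      using less.prems(2) unfolding T_def by (auto simp: sa[symmetric] v)
    have "dim T < dim S"
    proof (rule dim_psubset)
      have "v \<in> S - T" using v vv by (auto simp: T_def)
      moreover have "T \<subseteq> S" by (auto simp: T_def)
      ultimately show "span T \<subset> span S"
        using T less.prems(1) by (auto simp: span_eq_iff[THEN iffD2])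
    qed
    then obtain B where B: "pairwise orthogonal B" "\<forall>b\<in>B. norm b = 1 \<and> (\<exists>c. f b = c *\<^sub>R b)" "span B = T"
      using less.hyps T fT by blast
    have BT: "B \<subseteq> T" using B(3) span_superset by blast
    have "pairwise orthogonal (insert v B)"
      using B(1) BT by (auto simp: pairwise_insert T_def orthogonal_def inner_commute)
    moreover have "span (insert v B) = S"
    proof (intro subset_antisym subsetI)
      fix x assume "x \<in> span (insert v B)"
      moreover have "insert v B \<subseteq> S" using v BT by (auto simp: T_def)
      ultimately show "x \<in> S" using less.prems(1) span_minimal by blast
    next
      fix x assume "x \<in> S"
      then have "x - (v \<bullet> x) *\<^sub>R v \<in> T"
        unfolding T_def using v less.prems(1)
        by (auto simp: vv inner_diff_right intro!: subspace_diff subspace_scale)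
      then show "x \<in> span (insert v B)" using B(3) span_breakdown_eq by blast
    qed
    ultimately show ?thesis using B(2) v by (intro exI[of _ "insert v B"]) auto
  qed
qed

section \<open>Spectral decomposition and the characteristic polynomial\<close>

definition diag_mat :: "('n \<Rightarrow> real) \<Rightarrow> real ^ 'n ^ 'n" where
  "diag_mat d = (\<chi> i j. if i = j then d i else 0)"

lemma diag_mat_mult_vec: "diag_mat d *v x = (\<chi> i. d i * x $ i)"
  by (simp add: diag_mat_def matrix_vector_mult_def vec_eq_iff if_distrib[of "\<lambda>y. y * _"] sum.delta
      cong: if_cong)

lemma symmetric_inner:
  fixes A :: "real ^ 'n ^ 'n"
  assumes "transpose A = A"
  shows "(A *v x) \<bullet> y = x \<bullet> (A *v y)"
  by (metis assms dot_lmul_matrix vector_transpose_matrix)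

theorem spectral_theorem:
  fixes A :: "real ^ 'n ^ 'n"
  assumes "transpose A = A"
  obtains Q d where "orthogonal_matrix Q" "A = Q ** diag_mat d ** transpose Q"
proof -
  obtain B where B: "pairwise orthogonal B" "\<forall>b\<in>B. norm b = 1 \<and> (\<exists>c. A *v b = c *\<^sub>R b)"
    and spB: "span B = UNIV"
    using selfadjoint_eigenbasis[of "(*v) A" UNIV] symmetric_inner[OF assms] by auto
  have "0 \<notin> B" using B(2) by force
  then have ind: "independent B" using B(1) pairwise_orthogonal_independent by blast
  then have "card B = CARD('n)"
    using spB by (metis dim_UNIV dim_span dim_eq_card_independent DIM_cart DIM_real mult_1_right)
  moreover have "finite B" using ind finiteI_independent by blast
  ultimately obtain h where h: "bij_betw h (UNIV :: 'n set) B"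
    by (metis finite bij_betw_iff_card)
  then have hB: "h i \<in> B" for i by (auto simp: bij_betw_def)
  have "\<forall>i. \<exists>c. A *v h i = c *\<^sub>R h i" using B(2) hB by blast
  then obtain d where d: "\<And>i. A *v h i = d i *\<^sub>R h i" by metis
  define Q :: "real ^ 'n ^ 'n" where "Q = (\<chi> i j. h j $ i)"
  have col: "column j Q = h j" for j by (simp add: Q_def column_def vec_eq_iff)
  have Q: "orthogonal_matrix Q"
    unfolding orthogonal_matrix_orthonormal_columns col
  proof (intro conjI allI impI)
    fix i j :: 'n assume "i \<noteq> j"
    then have "h i \<noteq> h j" using h by (auto simp: bij_betw_def inj_on_def)
    then show "orthogonal (h i) (h j)" using B(1) hB by (auto simp: pairwise_def)
  qed (use B(2) hB in auto)
  have AQ: "A ** Q = Q ** diag_mat d"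
  proof -
    have "(A ** Q) $ i $ j = (Q ** diag_mat d) $ i $ j" for i j
    proof -
      have "(A ** Q) $ i $ j = (A *v h j) $ i"
        by (simp add: matrix_matrix_mult_def matrix_vector_mult_def Q_def)
      also have "\<dots> = (Q ** diag_mat d) $ i $ j"
        unfolding d by (simp add: matrix_matrix_mult_def diag_mat_def Q_def if_distrib sum.delta cong: if_cong)
      finally show ?thesis .
    qed
    then show ?thesis by (simp add: vec_eq_iff)
  qed
  have "A = A ** (Q ** transpose Q)"
    using Q by (simp add: orthogonal_matrix_def)
  also have "\<dots> = Q ** diag_mat d ** transpose Q"
    by (simp add: matrix_mul_assoc AQ)
  finally show ?thesis using Q that by blast
qed

text \<open>The entrywise embedding into polynomial matrices is multiplicative and
  \<open>mat [:0, 1:]\<close> commutes with everything, so the conjugation by Q can be pulled out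
  and cancels in the determinant.\<close>

lemma charpoly_spectral:
  fixes Q :: "real ^ 'n ^ 'n"
  assumes "orthogonal_matrix Q"
  shows "charpoly (Q ** diag_mat d ** transpose Q) = (\<Prod>i\<in>UNIV. [:- d i, 1:])"
proof -
  let ?c = "map_matrix (\<lambda>a::real. [:a:]) :: real ^ 'n ^ 'n \<Rightarrow> real poly ^ 'n ^ 'n"
  have sum_const: "(\<Sum>k\<in>K. [:g k:]) = [:\<Sum>k\<in>K. g k:]" for g :: "'n \<Rightarrow> real" and K
    by (induction K rule: infinite_finite_induct) auto
  have cm: "?c (X ** Y) = ?c X ** ?c Y" for X Y
    by (simp add: vec_eq_iff matrix_matrix_mult_def sum_const mult.commute)
  have c1: "?c (mat 1) = mat 1"
    by (simp add: vec_eq_iff mat_def one_pCons)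
  let ?X = "mat [:0, 1:] :: real poly ^ 'n ^ 'n"
  have comm: "Y ** ?X = ?X ** Y" for Y :: "real poly ^ 'n ^ 'n"
    by (simp add: vec_eq_iff matrix_matrix_mult_def mat_def if_distrib if_distribR sum.delta cong: if_cong)
  have diff: "Y ** (Z - W) = Y ** Z - Y ** W" "(Z - W) ** Y = Z ** Y - W ** Y"
    for Y Z W :: "real poly ^ 'n ^ 'n"
    by (simp_all add: vec_eq_iff matrix_matrix_mult_def sum_subtractf algebra_simps)
  have one: "?c Q ** ?c (transpose Q) = mat 1"
    using assms c1 by (simp add: cm[symmetric] orthogonal_matrix_def)
  have "?X - ?c (Q ** diag_mat d ** transpose Q) = ?c Q ** (?X - ?c (diag_mat d)) ** ?c (transpose Q)"
    by (simp add: cm diff comm)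
       (simp add: one flip: matrix_mul_assoc)
  then have "charpoly (Q ** diag_mat d ** transpose Q)
      = det (?c Q ** ?c (transpose Q)) * det (?X - ?c (diag_mat d))"
    by (simp add: charpoly_def det_mul)
  also have "\<dots> = (\<Prod>i\<in>UNIV. [:- d i, 1:])"
    unfolding one det_I by (subst det_diagonal) (auto simp: diag_mat_def mat_def)
  finally show ?thesis .
qed

lemma mset_eigenvalues_spectral:
  fixes Q :: "real ^ 'n ^ 'n"
  assumes "orthogonal_matrix Q"
  shows "mset (eigenvalues (Q ** diag_mat d ** transpose Q)) = image_mset d (mset_set UNIV)"
proof -
  have "(\<Sum>i\<in>K. {#d i#}) = image_mset d (mset_set K)" if "finite K" for K
    using that by (induction K) auto
  then show ?thesis
    by (simp add: eigenvalues_def charpoly_spectral[OF assms] proots_prod)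
qed

text \<open>If position i violated the order, with c the i-th entry of \<open>ys\<close>, then the n
  - i entries of \<open>xs\<close> from i on would exceed c, whereas only the n - i - 1 entries of
  \<open>ys\<close> after i can.\<close>

lemma sorted_counting_list_all2:
  fixes xs ys :: "real list"
  assumes "sorted xs" "sorted ys" and len: "length xs = length ys"
    and cnt: "\<And>c. length (filter (\<lambda>x. c < x) xs) \<le> length (filter (\<lambda>x. c < x) ys)"
  shows "list_all2 (\<le>) xs ys"
proof (rule list_all2_all_nthI[OF len], rule ccontr)
  fix i assume i: "i < length xs" and "\<not> xs ! i \<le> ys ! i"
  then have gt: "ys ! i < xs ! i" by simp
  let ?c = "ys ! i" and ?n = "length xs"
  have "{i..<?n} \<subseteq> {j. j < ?n \<and> ?c < xs ! j}"
    using gt sorted_nth_mono[OF assms(1)] by (auto intro: less_le_trans)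
  then have "card {i..<?n} \<le> card {j. j < ?n \<and> ?c < xs ! j}"
    by (intro card_mono) auto
  then have "?n - i \<le> length (filter (\<lambda>x. ?c < x) xs)"
    by (simp add: length_filter_conv_card)
  also have "\<dots> \<le> length (filter (\<lambda>x. ?c < x) ys)" by (rule cnt)
  also have "{j. j < ?n \<and> ?c < ys ! j} \<subseteq> {i<..<?n}"
  proof (clarsimp, rule ccontr)
    fix j assume "j < ?n" "?c < ys ! j" "\<not> i < j"
    then show False using sorted_nth_mono[OF assms(2), of j i] i len by simp
  qed
  then have "length (filter (\<lambda>x. ?c < x) ys) \<le> card {i<..<?n}"
    unfolding length_filter_conv_card len[symmetric] by (intro card_mono) auto
  finally show False using i by simp
qed

lemma quadratic_form_spectral:
  fixes Q :: "real ^ 'n ^ 'n"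
  shows "x \<bullet> ((Q ** diag_mat d ** transpose Q) *v x) = (\<Sum>i\<in>UNIV. d i * ((transpose Q *v x) $ i)\<^sup>2)"
proof -
  have "x \<bullet> ((Q ** diag_mat d ** transpose Q) *v x) = (transpose Q *v x) \<bullet> (diag_mat d *v (transpose Q *v x))"
    by (metis dot_lmul_matrix matrix_vector_mul_assoc transpose_transpose vector_transpose_matrix)
  then show ?thesis
    by (simp add: diag_mat_mult_vec inner_vec_def power2_eq_square mult_ac)
qed

text \<open>Weyl's monotonicity principle: were the count to drop, the eigenspaces of \<open>A\<close> above \<open>c\<close>
  and of \<open>B\<close> up to \<open>c\<close> would intersect for dimension reasons.\<close>

lemma eigenvalue_count_mono:
  fixes P Q :: "real ^ 'n ^ 'n"
  assumes P: "orthogonal_matrix P" and Q: "orthogonal_matrix Q"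
    and le: "\<And>x. x \<bullet> ((P ** diag_mat d ** transpose P) *v x) \<le> x \<bullet> ((Q ** diag_mat e ** transpose Q) *v x)"
  shows "card {i. c < d i} \<le> card {i. c < e i}"
proof (rule ccontr)
  assume "\<not> card {i. c < d i} \<le> card {i. c < e i}"
  then have cards: "card {i. c < e i} < card {i. c < d i}" by simp
  define U where "U = ((*v) P) ` {y. \<forall>i. i \<notin> {i. c < d i} \<longrightarrow> y $ i = 0}"
  define V where "V = ((*v) Q) ` {y. \<forall>i. i \<notin> {i. e i \<le> c} \<longrightarrow> y $ i = 0}"
  have inv: "transpose M *v (M *v y) = y" if "orthogonal_matrix M" for M :: "real ^ 'n ^ 'n" and y
    using that by (simp add: matrix_vector_mul_assoc orthogonal_matrix_def)
  have sub: "subspace {y :: real ^ 'n. \<forall>i. i \<notin> K \<longrightarrow> y $ i = 0}" for K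
    by (auto simp: subspace_def)
  have dimI: "dim (((*v) M) ` {y. \<forall>i. i \<notin> K \<longrightarrow> y $ i = 0}) = card K"
    if "orthogonal_matrix M" for M :: "real ^ 'n ^ 'n" and K
  proof -
    have "inj ((*v) M)" using inv[OF that] by (metis injI)
    then have "dim (((*v) M) ` {y. \<forall>i. i \<notin> K \<longrightarrow> y $ i = 0}) = dim {y :: real ^ 'n. \<forall>i. i \<notin> K \<longrightarrow> y $ i = 0}"
      by (intro dim_image_eq) (auto intro: inj_on_subset)
    then show ?thesis using dim_substandard_cart[of K, where 'a = real] by (simp add: dim_vec_eq)
  qed
  have sU: "subspace U" and sV: "subspace V"
    unfolding U_def V_def by (intro linear_subspace_image sub matrix_vector_mul_linear)+
  have "dim {x + y |x y. x \<in> U \<and> y \<in> V} + dim (U \<inter> V) = dim U + dim V"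
    by (rule dim_sums_Int[OF sU sV])
  moreover have "dim {x + y |x y. x \<in> U \<and> y \<in> V} \<le> CARD('n)"
    using dim_subset_UNIV[of "{x + y |x y. x \<in> U \<and> y \<in> V}"] by simp
  moreover have "{i. e i \<le> c} = UNIV - {i. c < e i}" by auto
  then have "card {i. e i \<le> c} = CARD('n) - card {i. c < e i}" by (simp add: card_Diff_subset)
  moreover have "card {i. c < e i} \<le> CARD('n)" by (intro card_mono) auto
  ultimately have "dim (U \<inter> V) > 0"
    using dimI[OF P, of "{i. c < d i}"] dimI[OF Q, of "{i. e i \<le> c}"] cards
    unfolding U_def[symmetric] V_def[symmetric] by linarith
  then have "\<not> U \<inter> V \<subseteq> {0}" by (simp only: dim_eq_0[symmetric])
  then obtain x where x: "x \<in> U" "x \<in> V" "x \<noteq> 0" by blast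
  obtain y where y: "x = P *v y" "\<And>i. \<not> c < d i \<Longrightarrow> y $ i = 0" using x(1) by (auto simp: U_def)
  obtain z where z: "x = Q *v z" "\<And>i. \<not> e i \<le> c \<Longrightarrow> z $ i = 0" using x(2) by (auto simp: V_def)
  have ty: "transpose P *v x = y" and tz: "transpose Q *v x = z"
    using inv[OF P, of y] inv[OF Q, of z] by (simp_all only: y(1)[symmetric] z(1)[symmetric])
  have nrm: "(\<Sum>i\<in>UNIV. ((transpose M *v x) $ i)\<^sup>2) = x \<bullet> x" if "orthogonal_matrix M" for M :: "real ^ 'n ^ 'n"
  proof -
    have "(\<Sum>i\<in>UNIV. ((transpose M *v x) $ i)\<^sup>2) = (transpose M *v x) \<bullet> (transpose M *v x)"
      by (simp add: inner_vec_def power2_eq_square)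
    also have "\<dots> = x \<bullet> ((M ** transpose M) *v x)"
      by (metis dot_lmul_matrix matrix_vector_mul_assoc transpose_transpose vector_transpose_matrix)
    finally show ?thesis using that by (simp add: orthogonal_matrix_def)
  qed
  obtain i where i: "y $ i \<noteq> 0"
    using x(3) y(1) by (metis matrix_vector_mult_0_right vec_eq_iff zero_index)
  \<comment> \<open>On the common vector x the form of A lies strictly above c |x|^2, by a nonzero
    coordinate of y, and the form of B does not.\<close>
  have "c * (x \<bullet> x) = (\<Sum>i\<in>UNIV. c * (y $ i)\<^sup>2)"
    using nrm[OF P] unfolding ty by (simp flip: sum_distrib_left)
  also have "\<dots> < (\<Sum>i\<in>UNIV. d i * (y $ i)\<^sup>2)"
  proof (rule sum_strict_mono_ex1)
    show "\<forall>i\<in>UNIV. c * (y $ i)\<^sup>2 \<le> d i * (y $ i)\<^sup>2"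
      using y(2) by (metis less_le mult_right_mono mult_zero_right power_zero_numeral zero_le_power2 order_refl)
    show "\<exists>i\<in>UNIV. c * (y $ i)\<^sup>2 < d i * (y $ i)\<^sup>2"
      using i y(2)[of i] by (intro bexI[of _ i]) auto
  qed simp
  also have "\<dots> \<le> (\<Sum>i\<in>UNIV. e i * (z $ i)\<^sup>2)"
    using le[of x] unfolding quadratic_form_spectral ty tz .
  also have "\<dots> \<le> (\<Sum>i\<in>UNIV. c * (z $ i)\<^sup>2)"
  proof (rule sum_mono)
    fix i show "e i * (z $ i)\<^sup>2 \<le> c * (z $ i)\<^sup>2"
      using z(2)[of i] by (cases "e i \<le> c") (auto intro: mult_right_mono)
  qed
  also have "\<dots> = c * (x \<bullet> x)"
    using nrm[OF Q] unfolding tz by (simp flip: sum_distrib_left)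
  finally show False by simp
qed

lemma eigenvalues_mono:
  fixes A B :: "real ^ 'n ^ 'n"
  assumes "transpose A = A" "transpose B = B" and le: "\<And>x. x \<bullet> (A *v x) \<le> x \<bullet> (B *v x)"
  shows "list_all2 (\<le>) (eigenvalues A) (eigenvalues B)"
proof -
  obtain P d where P: "orthogonal_matrix P" "A = P ** diag_mat d ** transpose P"
    using assms(1) by (rule spectral_theorem)
  obtain Q e where Q: "orthogonal_matrix Q" "B = Q ** diag_mat e ** transpose Q"
    using assms(2) by (rule spectral_theorem)
  have mA: "mset (eigenvalues A) = image_mset d (mset_set UNIV)"
    and mB: "mset (eigenvalues B) = image_mset e (mset_set UNIV)"
    using mset_eigenvalues_spectral P Q by auto
  have cnt: "length (filter (\<lambda>x. c < x) ls) = card {i. c < f i}"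
    if "mset ls = image_mset f (mset_set (UNIV :: 'n set))" for ls f c
  proof -
    have "length (filter (\<lambda>x. c < x) ls) = size (filter_mset (\<lambda>x. c < x) (mset ls))"
      by (simp flip: mset_filter)
    then show ?thesis
      unfolding that by (simp add: filter_mset_image_mset filter_mset_mset_set)
  qed
  show ?thesis
  proof (rule sorted_counting_list_all2)
    show "sorted (eigenvalues A)" "sorted (eigenvalues B)" by (auto simp: eigenvalues_def)
    show "length (eigenvalues A) = length (eigenvalues B)"
      using mA mB by (metis size_image_mset size_mset)
    show "length (filter (\<lambda>x. c < x) (eigenvalues A)) \<le> length (filter (\<lambda>x. c < x) (eigenvalues B))" for c
      unfolding cnt[OF mA] cnt[OF mB]
      using eigenvalue_count_mono[OF P(1) Q(1)] le P(2) Q(2) by blast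
  qed
qed

text \<open>This is the ellipticity of the operator. The cone condition is imposed on the smaller
  matrix, and raising eigenvalues preserves it.\<close>

lemma elem_sym_eigenvalues_mono:
  fixes A B :: "real ^ 'n ^ 'n"
  assumes "transpose A = A" "transpose B = B" "\<And>x. x \<bullet> (A *v x) \<le> x \<bullet> (B *v x)"
    and pos: "\<And>j. j \<in> {1..k} \<Longrightarrow> elem_sym j (eigenvalues A) > 0"
  shows "elem_sym k (eigenvalues A) \<le> elem_sym k (eigenvalues B)"
  using esym_mono_list_all2[OF eigenvalues_mono[OF assms(1-3)], of k "{#}" k] pos
  by (simp add: elem_sym_eq_esym garding_cone_def)

section \<open>Homogeneity and rotation invariance\<close>

lemma esym_scale: "esym (image_mset ((*) c) M) j = c ^ j * esym M j"
proof (induction M arbitrary: j)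
  case empty
  then show ?case by (cases j) (simp_all add: esym_def gen_poly_def)
next
  case (add x M)
  then show ?case by (cases j) (simp_all add: esym_add_Suc algebra_simps)
qed

text \<open>Serves the time factor of self-similar solutions (M the identity), dilated and rotated
  profiles, and the zero matrix (c = 0).\<close>

lemma elem_sym_eigenvalues_conformal:
  fixes A M :: "real ^ 'n ^ 'n"
  assumes A: "transpose A = A" and M: "orthogonal_matrix M"
  shows "elem_sym j (eigenvalues (c *\<^sub>R (transpose M ** A ** M))) = c ^ j * elem_sym j (eigenvalues A)"
proof -
  obtain Q d where Q: "orthogonal_matrix Q" "A = Q ** diag_mat d ** transpose Q"
    using A by (rule spectral_theorem)
  define R where "R = transpose M ** Q"
  have R: "orthogonal_matrix R"
    unfolding R_def using M Q by (intro orthogonal_matrix_mul) auto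
  have "diag_mat (\<lambda>i. c * d i) = c *\<^sub>R diag_mat d"
    by (simp add: diag_mat_def vec_eq_iff)
  then have "c *\<^sub>R (transpose M ** A ** M) = R ** diag_mat (\<lambda>i. c * d i) ** transpose R"
    unfolding Q R_def
    by (simp add: matrix_transpose_mul matrix_mul_assoc matrix_scalar_ac flip: scalar_matrix_assoc)
  then have "mset (eigenvalues (c *\<^sub>R (transpose M ** A ** M))) = image_mset ((*) c) (mset (eigenvalues A))"
    using mset_eigenvalues_spectral[OF R, of "\<lambda>i. c * d i"] mset_eigenvalues_spectral[OF Q(1), of d] Q(2)
    by (simp add: multiset.map_comp o_def)
  then show ?thesis by (simp add: elem_sym_eq_esym esym_scale)
qed

section \<open>Hessians\<close>

text \<open>Twice differentiability at x with the Hessian as an argument, which avoids computing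
  with \<open>frechet_derivative\<close>. Differentiability near x gives \<open>gradient f\<close>
  its meaning at the points where its own derivative is formed.\<close>

definition has_hessian :: "(real ^ 'n \<Rightarrow> real) \<Rightarrow> real ^ 'n ^ 'n \<Rightarrow> real ^ 'n \<Rightarrow> bool" where
  "has_hessian f H x \<longleftrightarrow> (\<forall>\<^sub>F y in nhds x. f differentiable (at y))
     \<and> (gradient f has_derivative ((*v) H)) (at x)"

lemma gradient_works:
  assumes "f differentiable (at y)"
  shows "(f has_derivative (\<lambda>h. gradient f y \<bullet> h)) (at y)"
proof -
  have D: "(f has_derivative frechet_derivative f (at y)) (at y)"
    using assms frechet_derivative_works by blast
  then have lin: "linear (frechet_derivative f (at y))"
    using has_derivative_linear by blast
  have "frechet_derivative f (at y) h = gradient f y \<bullet> h" for h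
  proof -
    have "frechet_derivative f (at y) h
        = frechet_derivative f (at y) (\<Sum>i\<in>UNIV. h $ i *\<^sub>R axis i 1)"
      using basis_expansion[of h] by (simp add: scalar_mult_eq_scaleR)
    also have "\<dots> = gradient f y \<bullet> h"
      by (simp add: linear_sum[OF lin] linear_scale[OF lin] gradient_def inner_vec_def mult.commute)
    finally show ?thesis .
  qed
  then have "frechet_derivative f (at y) = (\<bullet>) (gradient f y)" by (rule ext)
  then show ?thesis using D by simp
qed

lemma gradient_eqI:
  assumes "(f has_derivative (\<lambda>h. g \<bullet> h)) (at y)"
  shows "gradient f y = g"
proof -
  have "(\<lambda>h. g \<bullet> h) = frechet_derivative f (at y)"
    using assms by (rule frechet_derivative_at)
  then have "frechet_derivative f (at y) (axis i 1) = g \<bullet> axis i 1" for i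
    by metis
  then show ?thesis by (simp add: gradient_def vec_eq_iff inner_axis)
qed

lemma C2_on_has_hessian:
  assumes "C2_on f S" "open S" "x \<in> S"
  shows "has_hessian f (hessian f x) x"
proof -
  have "\<forall>\<^sub>F y in nhds x. f differentiable (at y)"
    using assms unfolding C2_on_def eventually_nhds
    by (metis differentiable_on_eq_differentiable_at)
  moreover have "(gradient f has_derivative frechet_derivative (gradient f) (at x)) (at x)"
    using assms unfolding C2_on_def
    by (metis differentiable_on_eq_differentiable_at frechet_derivative_works)
  moreover from this have "(*v) (hessian f x) = frechet_derivative (gradient f) (at x)"
    unfolding hessian_def using has_derivative_linear
    by (metis matrix_vector_mul(1) linear_matrix_vector_mul_eq)
  ultimately show ?thesis by (simp add: has_hessian_def)
qed

lemma has_real_derivative_along_line: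
  assumes "f differentiable (at (a + t *\<^sub>R b))"
  shows "((\<lambda>t. f (a + t *\<^sub>R b)) has_real_derivative gradient f (a + t *\<^sub>R b) \<bullet> b) (at t)"
proof -
  have "((\<lambda>t. f (a + t *\<^sub>R b)) has_derivative (\<lambda>s. gradient f (a + t *\<^sub>R b) \<bullet> (s *\<^sub>R b))) (at t)"
    by (rule has_derivative_compose[where f = "\<lambda>t. a + t *\<^sub>R b" and g = f, OF _ gradient_works[OF assms]])
      (auto intro!: derivative_eq_intros)
  then show ?thesis
    unfolding has_field_derivative_def by (rule has_derivative_eq_rhs) (simp add: fun_eq_iff)
qed

text \<open>The mean value theorem is used in direction h; the step in direction k is then
  controlled by differentiability of the gradient at x alone. The left expression is symmetric in h
  and k, which is its purpose.\<close>

lemma has_hessian_second_difference: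
  fixes f :: "real ^ 'n \<Rightarrow> real"
  assumes "has_hessian f H x" "e > 0"
  shows "\<exists>d>0. \<forall>s. 0 < s \<longrightarrow> s < d \<longrightarrow>
    \<bar>(f (x + s *\<^sub>R h + s *\<^sub>R k) - f (x + s *\<^sub>R h) - f (x + s *\<^sub>R k) + f x) - s\<^sup>2 * (h \<bullet> (H *v k))\<bar>
      \<le> e * s\<^sup>2"
proof -
  \<comment> \<open>All points involved lie within s C of x. Two gradient remainders of size e' s C,
    paired with h and multiplied by s, then add up to at most e s^2.\<close>
  define C where "C = norm h + norm k + 1"
  have C: "C > 0" "norm h \<le> C" "norm k \<le> C" unfolding C_def by (auto intro: add_nonneg_pos)
  define e' where "e' = e / (2 * C\<^sup>2)"
  have e': "e' > 0" using assms(2) C by (simp add: e'_def)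
  obtain d1 where d1: "d1 > 0" "\<And>y. dist y x < d1 \<Longrightarrow> f differentiable (at y)"
    using assms(1) unfolding has_hessian_def eventually_nhds_metric by blast
  obtain d2 where d2: "d2 > 0"
    "\<And>y. norm (y - x) < d2 \<Longrightarrow> norm (gradient f y - gradient f x - H *v (y - x)) \<le> e' * norm (y - x)"
    using assms(1) e' unfolding has_hessian_def has_derivative_at_alt by blast
  define d where "d = min d1 d2 / C"
  have "d > 0" using d1 d2 C by (simp add: d_def)
  moreover have "\<bar>(f (x + s *\<^sub>R h + s *\<^sub>R k) - f (x + s *\<^sub>R h) - f (x + s *\<^sub>R k) + f x) - s\<^sup>2 * (h \<bullet> (H *v k))\<bar>
      \<le> e * s\<^sup>2" if s: "0 < s" "s < d" for s
  proof -
    have sC: "s * C < d1" "s * C < d2" using s C by (auto simp: d_def pos_less_divide_eq)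
    have small: "norm (t *\<^sub>R h + r *\<^sub>R k) \<le> s * C" if "0 \<le> t" "t \<le> s" "0 \<le> r" "r \<le> s" for t r
    proof -
      have "norm (t *\<^sub>R h + r *\<^sub>R k) \<le> t * norm h + r * norm k"
        using norm_triangle_ineq[of "t *\<^sub>R h" "r *\<^sub>R k"] that by simp
      also have "\<dots> \<le> s * norm h + s * norm k"
        using that by (intro add_mono mult_right_mono) auto
      also have "\<dots> \<le> s * C" using s by (simp add: C_def algebra_simps)
      finally show ?thesis .
    qed
    have diff: "f differentiable (at (x + t *\<^sub>R h + r *\<^sub>R k))" if "0 \<le> t" "t \<le> s" "0 \<le> r" "r \<le> s" for t r
      using small[OF that] sC by (intro d1(2)) (simp add: dist_norm algebra_simps)
    define G where "G = gradient f"
    define rm where "rm y = G y - G x - H *v (y - x)" for y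
    have rm: "norm (rm (x + t *\<^sub>R h + r *\<^sub>R k)) \<le> e' * (s * C)" if "0 \<le> t" "t \<le> s" "0 \<le> r" "r \<le> s" for t r
    proof -
      have "norm (x + t *\<^sub>R h + r *\<^sub>R k - x) \<le> s * C" using small[OF that] by (simp add: algebra_simps)
      moreover from this have "norm (rm (x + t *\<^sub>R h + r *\<^sub>R k)) \<le> e' * norm (x + t *\<^sub>R h + r *\<^sub>R k - x)"
        unfolding rm_def G_def using sC by (intro d2) linarith
      ultimately show ?thesis using e' by (meson mult_left_mono less_imp_le order_trans)
    qed
    \<comment> \<open>The increment in direction k, as a function of the displacement along h;
      \<open>\<phi> s - \<phi> 0\<close> is the mixed second difference.\<close>
    define \<phi> where "\<phi> t = f ((x + s *\<^sub>R k) + t *\<^sub>R h) - f (x + t *\<^sub>R h)" for t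
    have "\<exists>z>0. z < s \<and> \<phi> s - \<phi> 0 = (s - 0) * (G ((x + s *\<^sub>R k) + z *\<^sub>R h) \<bullet> h - G (x + z *\<^sub>R h) \<bullet> h)"
    proof (rule MVT2[OF s(1)])
      fix t assume t: "0 \<le> t" "t \<le> s"
      have "f differentiable (at ((x + s *\<^sub>R k) + t *\<^sub>R h))" "f differentiable (at (x + t *\<^sub>R h))"
        using diff[OF t, of s] diff[OF t, of 0] s by (simp_all add: algebra_simps)
      then show "(\<phi> has_real_derivative G ((x + s *\<^sub>R k) + t *\<^sub>R h) \<bullet> h - G (x + t *\<^sub>R h) \<bullet> h) (at t)"
        unfolding \<phi>_def G_def by (intro DERIV_diff has_real_derivative_along_line)
    qed
    then obtain z where z: "0 < z" "z < s"
      "\<phi> s - \<phi> 0 = s * ((G ((x + s *\<^sub>R k) + z *\<^sub>R h) - G (x + z *\<^sub>R h)) \<bullet> h)"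
      by (auto simp: inner_diff_left)
    let ?p = "x + z *\<^sub>R h + s *\<^sub>R k" and ?q = "x + z *\<^sub>R h + 0 *\<^sub>R k"
    have pq: "(x + s *\<^sub>R k) + z *\<^sub>R h = ?p" by simp
    have z3: "\<phi> s - \<phi> 0 = s * ((G ?p - G ?q) \<bullet> h)"
      using z(3) unfolding pq by simp
    have "H *v (?p - x) - H *v (?q - x) = s *\<^sub>R (H *v k)"
      by (simp flip: matrix_vector_mult_diff_distrib matrix_vector_mult_scaleR)
    then have "G ?p - G ?q = s *\<^sub>R (H *v k) + (rm ?p - rm ?q)"
      unfolding rm_def by (simp add: algebra_simps)
    then have "\<phi> s - \<phi> 0 - s\<^sup>2 * (h \<bullet> (H *v k)) = s * ((rm ?p - rm ?q) \<bullet> h)"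
      unfolding z3 by (simp add: inner_add_left power2_eq_square distrib_left inner_commute[of h])
    then have "\<bar>\<phi> s - \<phi> 0 - s\<^sup>2 * (h \<bullet> (H *v k))\<bar> = \<bar>s * ((rm ?p - rm ?q) \<bullet> h)\<bar>" by simp
    also have "\<dots> \<le> s * (norm (rm ?p - rm ?q) * norm h)"
      using s Cauchy_Schwarz_ineq2[of "rm ?p - rm ?q" h] by (simp add: abs_mult)
    also have "\<dots> \<le> s * ((2 * (e' * (s * C))) * C)"
    proof -
      have "norm (rm ?p - rm ?q) \<le> norm (rm ?p) + norm (rm ?q)" by (rule norm_triangle_ineq4)
      also have "\<dots> \<le> 2 * (e' * (s * C))"
        using rm[of z s] rm[of z 0] z s by simp
      finally show ?thesis using s C e'
        by (intro mult_left_mono mult_mono) auto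
    qed
    also have "\<dots> = e * s\<^sup>2"
      using C by (simp add: e'_def power2_eq_square)
    finally show ?thesis by (simp add: \<phi>_def algebra_simps)
  qed
  ultimately show ?thesis by blast
qed

text \<open>Schwarz's theorem: swapping h and k leaves the mixed second difference unchanged, so
  both bilinear values, scaled by s^2, are within e s^2 of it.\<close>

lemma has_hessian_symmetric:
  fixes f :: "real ^ 'n \<Rightarrow> real"
  assumes "has_hessian f H x"
  shows "transpose H = H"
proof -
  have eq: "h \<bullet> (H *v k) = k \<bullet> (H *v h)" for h k
  proof -
    have small: "\<bar>h \<bullet> (H *v k) - k \<bullet> (H *v h)\<bar> \<le> 2 * e" if e: "e > 0" for e
    proof -
      define D where "D s = f (x + s *\<^sub>R h + s *\<^sub>R k) - f (x + s *\<^sub>R h) - f (x + s *\<^sub>R k) + f x" for s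
      obtain d1 where d1: "d1 > 0" "\<And>s. 0 < s \<Longrightarrow> s < d1 \<Longrightarrow> \<bar>D s - s\<^sup>2 * (h \<bullet> (H *v k))\<bar> \<le> e * s\<^sup>2"
        using has_hessian_second_difference[OF assms e, of h k] unfolding D_def by blast
      obtain d2 where d2: "d2 > 0" "\<And>s. 0 < s \<Longrightarrow> s < d2 \<Longrightarrow> \<bar>D s - s\<^sup>2 * (k \<bullet> (H *v h))\<bar> \<le> e * s\<^sup>2"
        using has_hessian_second_difference[OF assms e, of k h] unfolding D_def
        by (auto simp: algebra_simps)
      define s where "s = min d1 d2 / 2"
      have s: "0 < s" "s < d1" "s < d2" using d1 d2 by (auto simp: s_def)
      have "\<bar>s\<^sup>2 * (h \<bullet> (H *v k)) - s\<^sup>2 * (k \<bullet> (H *v h))\<bar> \<le> 2 * (e * s\<^sup>2)"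
        using d1(2)[OF s(1,2)] d2(2)[OF s(1,3)] by linarith
      then have "s\<^sup>2 * \<bar>h \<bullet> (H *v k) - k \<bullet> (H *v h)\<bar> \<le> s\<^sup>2 * (2 * e)"
        by (simp add: abs_mult mult_ac flip: right_diff_distrib left_diff_distrib)
      then show ?thesis using s(1) by simp
    qed
    have "\<bar>h \<bullet> (H *v k) - k \<bullet> (H *v h)\<bar> \<le> 0"
    proof (rule field_le_epsilon)
      fix e :: real assume "e > 0"
      then show "\<bar>h \<bullet> (H *v k) - k \<bullet> (H *v h)\<bar> \<le> 0 + e"
        using small[of "e / 2"] by simp
    qed
    then show ?thesis by simp
  qed
  have "H $ i $ j = H $ j $ i" for i j
    using eq[of "axis i 1" "axis j 1"]
    by (simp add: inner_axis' matrix_vector_mul_component inner_axis)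
  then show ?thesis by (simp add: transpose_def vec_eq_iff)
qed

lemma has_hessian_affine:
  fixes f :: "real ^ 'n \<Rightarrow> real" and M :: "real ^ 'n ^ 'n"
  assumes "has_hessian f H (p + M *v (x - q))"
  shows "has_hessian (\<lambda>y. c * f (p + M *v (y - q)) + b) (c *\<^sub>R (transpose M ** H ** M)) x"
proof -
  let ?g = "\<lambda>y. c * f (p + M *v (y - q)) + b" and ?a = "\<lambda>y. p + M *v (y - q)"
  have da: "(?a has_derivative (\<lambda>h. M *v h)) (at y)" for y
    by (auto intro!: derivative_eq_intros bounded_linear.has_derivative[OF matrix_vector_mul_bounded_linear])
  then have "isCont ?a x" using has_derivative_continuous by blast
  then have "filterlim ?a (nhds (?a x)) (nhds x)"
    unfolding isCont_def using tendsto_at_iff_tendsto_nhds[of ?a x] by simp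
  then have ev: "\<forall>\<^sub>F y in nhds x. f differentiable (at (?a y))"
    using assms unfolding has_hessian_def filterlim_iff by blast
  have dg: "(?g has_derivative (\<lambda>h. (c *\<^sub>R (transpose M *v gradient f (?a y))) \<bullet> h)) (at y)"
    if "f differentiable (at (?a y))" for y
  proof -
    have "(?g has_derivative (\<lambda>h. c * (gradient f (?a y) \<bullet> (M *v h)))) (at y)"
      by (auto intro!: derivative_eq_intros has_derivative_compose[OF da gradient_works[OF that]])
    then show ?thesis
      by (rule has_derivative_eq_rhs) (simp add: fun_eq_iff dot_lmul_matrix)
  qed
  have "\<forall>\<^sub>F y in nhds x. ?g differentiable (at y)"
    using ev by eventually_elim (metis dg differentiableI)
  moreover have "(gradient ?g has_derivative ((*v) (c *\<^sub>R (transpose M ** H ** M)))) (at x)"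
  proof -
    \<comment> \<open>The chain rule for the gradient holds only near x, so its derivative is
      transferred along an eventual equality.\<close>
    have evg: "\<forall>\<^sub>F y in nhds x. c *\<^sub>R (transpose M *v gradient f (?a y)) = gradient ?g y"
      using ev by eventually_elim (metis dg gradient_eqI)
    have "((\<lambda>y. c *\<^sub>R (transpose M *v gradient f (?a y))) has_derivative
        (\<lambda>h. c *\<^sub>R (transpose M *v (H *v (M *v h))))) (at x)"
      using assms unfolding has_hessian_def
      by (intro has_derivative_scaleR_right bounded_linear.has_derivative[OF matrix_vector_mul_bounded_linear]
          has_derivative_compose[OF da]) auto
    then have "(gradient ?g has_derivative (\<lambda>h. c *\<^sub>R (transpose M *v (H *v (M *v h))))) (at x)"
      by (rule has_derivative_transform_eventually)
        (use evg eventually_nhds_x_imp_x[OF evg] in \<open>auto simp: eventually_at_filter elim: eventually_mono\<close>)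
    then show ?thesis
      by (rule has_derivative_eq_rhs)
        (simp add: fun_eq_iff matrix_vector_mul_assoc scaleR_matrix_vector_assoc matrix_mul_assoc)
  qed
  ultimately show ?thesis by (simp add: has_hessian_def)
qed

lemma has_hessian_diff:
  assumes "has_hessian f A x" "has_hessian g B x"
  shows "has_hessian (\<lambda>y. f y - g y) (A - B) x"
proof -
  have ev: "\<forall>\<^sub>F y in nhds x. f differentiable (at y) \<and> g differentiable (at y)"
    using assms by (simp add: has_hessian_def eventually_conj)
  have D: "((\<lambda>y. f y - g y) has_derivative (\<lambda>h. (gradient f y - gradient g y) \<bullet> h)) (at y)"
    if "f differentiable (at y)" "g differentiable (at y)" for y
    unfolding inner_diff_left
    by (intro has_derivative_diff gradient_works that)
  have evg: "\<forall>\<^sub>F y in nhds x. gradient f y - gradient g y = gradient (\<lambda>y. f y - g y) y"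
    using ev by eventually_elim (metis D gradient_eqI)
  have "((\<lambda>y. gradient f y - gradient g y) has_derivative (\<lambda>h. A *v h - B *v h)) (at x)"
    using assms by (auto simp: has_hessian_def intro: has_derivative_diff)
  then have "(gradient (\<lambda>y. f y - g y) has_derivative (\<lambda>h. A *v h - B *v h)) (at x)"
    by (rule has_derivative_transform_eventually)
      (use evg eventually_nhds_x_imp_x[OF evg] in \<open>auto simp: eventually_at_filter elim: eventually_mono\<close>)
  then have "(gradient (\<lambda>y. f y - g y) has_derivative ((*v) (A - B))) (at x)"
    by (rule has_derivative_eq_rhs) (simp add: fun_eq_iff algebra_simps)
  moreover have "\<forall>\<^sub>F y in nhds x. (\<lambda>y. f y - g y) differentiable (at y)"
    using ev by eventually_elim auto
  ultimately show ?thesis by (simp add: has_hessian_def)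
qed

text \<open>Along a line the second derivative is known at the one point only. Were it positive
  there, the first derivative would be positive just to the right, and the mean value theorem would
  give a larger value.\<close>

lemma has_hessian_local_max:
  fixes f :: "real ^ 'n \<Rightarrow> real"
  assumes H: "has_hessian f H x" and max: "\<forall>\<^sub>F y in nhds x. f y \<le> f x"
  shows "v \<bullet> (H *v v) \<le> 0"
proof (rule ccontr)
  assume "\<not> v \<bullet> (H *v v) \<le> 0"
  then have pos: "(H *v v) \<bullet> v > 0" by (simp add: inner_commute)
  define \<psi> where "\<psi> t = f (x + t *\<^sub>R v)" for t
  define \<psi>' where "\<psi>' t = gradient f (x + t *\<^sub>R v) \<bullet> v" for t
  have line: "((\<lambda>t. x + t *\<^sub>R v) has_derivative (\<lambda>s. s *\<^sub>R v)) (at 0)"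
    by (auto intro!: derivative_eq_intros)
  have "((\<lambda>t. x + t *\<^sub>R v) \<longlongrightarrow> x + 0 *\<^sub>R v) (nhds (0::real))"
    by (intro tendsto_intros filterlim_ident)
  then have "\<forall>\<^sub>F t in nhds (0::real). f differentiable (at (x + t *\<^sub>R v)) \<and> f (x + t *\<^sub>R v) \<le> f x"
    using eventually_conj[OF _ max, of "\<lambda>y. f differentiable (at y)"] H
    unfolding has_hessian_def filterlim_iff by auto
  then obtain d where d: "d > 0" "\<And>t. \<bar>t\<bar> < d \<Longrightarrow> f differentiable (at (x + t *\<^sub>R v)) \<and> \<psi> t \<le> \<psi> 0"
    unfolding eventually_nhds_metric \<psi>_def by (auto simp: dist_real_def)
  have D1: "(\<psi> has_real_derivative \<psi>' t) (at t)" if "\<bar>t\<bar> < d" for t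
    unfolding \<psi>_def \<psi>'_def using d(2)[OF that] by (intro has_real_derivative_along_line) auto
  have "\<psi>' 0 = 0"
    using DERIV_local_max[OF D1[of 0] d(1)] d by (auto simp: abs_minus_commute)
  have "((\<lambda>t. gradient f (x + t *\<^sub>R v)) has_derivative (\<lambda>s. H *v (s *\<^sub>R v))) (at 0)"
    using H unfolding has_hessian_def by (intro has_derivative_compose[OF line]) auto
  then have "(\<psi>' has_derivative (\<lambda>s. (H *v (s *\<^sub>R v)) \<bullet> v)) (at 0)"
    unfolding \<psi>'_def by (rule has_derivative_inner_left)
  then have "(\<psi>' has_real_derivative (H *v v) \<bullet> v) (at 0)"
    unfolding has_field_derivative_def
    by (rule has_derivative_eq_rhs) (simp add: fun_eq_iff matrix_vector_mult_scaleR)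
  then obtain d2 where d2: "d2 > 0" "\<And>h. 0 < h \<Longrightarrow> h < d2 \<Longrightarrow> 0 < \<psi>' h"
    using has_real_derivative_pos_inc_right[of \<psi>' _ 0 UNIV] pos \<open>\<psi>' 0 = 0\<close> by auto
  define s where "s = min d d2 / 2"
  have s: "0 < s" "s < d" "s < d2" using d d2 by (auto simp: s_def)
  obtain z where "0 < z" "z < s" "\<psi> s - \<psi> 0 = (s - 0) * \<psi>' z"
    using MVT2[OF s(1), of \<psi> \<psi>'] D1 s by force
  moreover have "\<psi>' z > 0" using calculation s d2(2) by auto
  ultimately have "\<psi> s > \<psi> 0" using s(1) by (simp add: algebra_simps)
  then show False using d(2)[of s] s by auto
qed

section \<open>Comparison with self-similar solutions\<close>

text \<open>The equation and the cone condition at one point of space-time, in relational form, so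
  that u and the self-similar solutions are treated alike.\<close>

definition parabolic_at :: "nat \<Rightarrow> (real \<Rightarrow> real ^ 'n \<Rightarrow> real) \<Rightarrow> real \<Rightarrow> real ^ 'n \<Rightarrow> bool" where
  "parabolic_at k u t x \<longleftrightarrow> (\<exists>H. has_hessian (u t) H x
     \<and> (\<forall>j\<in>{1..k}. 0 < elem_sym j (eigenvalues H))
     \<and> ((\<lambda>s. u s x) has_real_derivative elem_sym k (eigenvalues H)) (at t))"

text \<open>Subtracting \<open>\<epsilon> t\<close> makes a first positive maximum of \<open>u - w\<close> strict in time, and there the
  Hessians are ordered, so the \<open>k\<close>-Hessian operators are ordered the wrong way round.\<close>

lemma parabolic_comparison:
  fixes D :: "(real ^ 'n) set"
  assumes D: "open D" "bounded D"
    and cu: "continuous_on ({0..} \<times> closure D) (\<lambda>(t, x). u t x)"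
    and cw: "continuous_on ({0..} \<times> closure D) (\<lambda>(t, x). w t x)"
    and pu: "\<And>t x. 0 < t \<Longrightarrow> x \<in> D \<Longrightarrow> parabolic_at k u t x"
    and pw: "\<And>t x. 0 < t \<Longrightarrow> x \<in> D \<Longrightarrow> parabolic_at k w t x"
    and init: "\<And>x. x \<in> closure D \<Longrightarrow> u 0 x \<le> w 0 x"
    and lat: "\<And>t x. 0 \<le> t \<Longrightarrow> x \<in> frontier D \<Longrightarrow> u t x \<le> w t x"
    and t: "0 \<le> t" and x: "x \<in> closure D"
  shows "u t x \<le> w t x"
proof (rule ccontr)
  assume neg: "\<not> u t x \<le> w t x"
  \<comment> \<open>Division by t + 1 makes \<epsilon> t smaller than the gap, so the penalised
    difference is still positive at (t, x).\<close>
  define \<epsilon> where "\<epsilon> = (u t x - w t x) / (t + 1)"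
  have e: "\<epsilon> > 0" unfolding \<epsilon>_def using neg t by simp
  have "\<epsilon> * (t + 1) = u t x - w t x" using t by (simp add: \<epsilon>_def)
  then have "\<epsilon> * t < u t x - w t x" using e by (simp add: distrib_left)
  define F where "F = (\<lambda>(s, y). u s y - w s y - \<epsilon> * s)"
  define K where "K = {0..t} \<times> closure D"
  have "compact K" unfolding K_def using D by (intro compact_Times) auto
  moreover have "continuous_on K F"
  proof -
    have "K \<subseteq> {0..} \<times> closure D" by (auto simp: K_def)
    then have "continuous_on K (\<lambda>p. (case p of (s, y) \<Rightarrow> u s y) - (case p of (s, y) \<Rightarrow> w s y) - \<epsilon> * fst p)"
      by (intro continuous_intros continuous_on_subset[OF cu] continuous_on_subset[OF cw])
    then show ?thesis unfolding F_def by (simp add: case_prod_unfold)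
  qed
  moreover have tx: "(t, x) \<in> K" using t x by (auto simp: K_def)
  ultimately obtain p where p: "p \<in> K" "\<And>q. q \<in> K \<Longrightarrow> F q \<le> F p"
    by (metis continuous_attains_sup empty_iff)
  obtain s y where sy: "p = (s, y)" by (cases p)
  have s: "0 \<le> s" "s \<le> t" and y: "y \<in> closure D" using p(1) by (auto simp: sy K_def)
  have "0 < F (t, x)" unfolding F_def using \<open>\<epsilon> * t < u t x - w t x\<close> by simp
  then have pos: "0 < u s y - w s y - \<epsilon> * s"
    using p(2)[OF tx] by (simp add: F_def sy)
  \<comment> \<open>Positivity at the maximum rules out the parabolic boundary, where u \<le>
    w.\<close>
  have s0: "0 < s"
    using s(1) pos init[OF y] by (cases "s = 0") auto
  have yD: "y \<in> D"
  proof (rule ccontr)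
    assume "y \<notin> D"
    then have "y \<in> frontier D" using y D(1) by (simp add: frontier_def interior_open)
    then have "u s y \<le> w s y" using lat s by blast
    moreover have "0 \<le> \<epsilon> * s" using e s by simp
    ultimately show False using pos by linarith
  qed
  obtain A where A: "has_hessian (u s) A y" "\<forall>j\<in>{1..k}. 0 < elem_sym j (eigenvalues A)"
    "((\<lambda>s. u s y) has_real_derivative elem_sym k (eigenvalues A)) (at s)"
    using pu[OF s0 yD] unfolding parabolic_at_def by blast
  obtain B where B: "has_hessian (w s) B y"
    "((\<lambda>s. w s y) has_real_derivative elem_sym k (eigenvalues B)) (at s)"
    using pw[OF s0 yD] unfolding parabolic_at_def by blast
  have "\<forall>\<^sub>F z in nhds y. u s z - w s z \<le> u s y - w s y"
    using eventually_nhds_in_open[OF D(1) yD]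
  proof eventually_elim
    case (elim z)
    then have "(s, z) \<in> K" using s closure_subset by (auto simp: K_def)
    then show ?case using p(2)[of "(s, z)"] by (simp add: F_def sy)
  qed
  then have "v \<bullet> ((A - B) *v v) \<le> 0" for v
    using has_hessian_local_max[OF has_hessian_diff[OF A(1) B(1)]] by blast
  then have "v \<bullet> (A *v v) \<le> v \<bullet> (B *v v)" for v
    by (simp add: matrix_vector_mult_diff_rdistrib inner_diff_right)
  then have le: "elem_sym k (eigenvalues A) \<le> elem_sym k (eigenvalues B)"
    using A B by (intro elem_sym_eigenvalues_mono has_hessian_symmetric) auto
  have "((\<lambda>s. u s y - w s y - \<epsilon> * s) has_real_derivative
      elem_sym k (eigenvalues A) - elem_sym k (eigenvalues B) - \<epsilon>) (at s)"
    using A(3) B(2) by (auto intro!: derivative_eq_intros)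
  \<comment> \<open>The time derivative is at most -\<epsilon>, so a slightly earlier time gives a
    larger value. Only earlier times are compared, as s may be the final time t.\<close>
  then obtain d where d: "d > 0"
    "\<And>h. 0 < h \<Longrightarrow> h < d \<Longrightarrow> u s y - w s y - \<epsilon> * s < u (s - h) y - w (s - h) y - \<epsilon> * (s - h)"
    using has_real_derivative_neg_dec_left[of "\<lambda>s. u s y - w s y - \<epsilon> * s" _ s UNIV] le e by force
  define h where "h = min d s / 2"
  have h: "0 < h" "h < d" "h \<le> s" using d s0 by (auto simp: h_def)
  have "(s - h, y) \<in> K" using h s y by (auto simp: K_def)
  then show False using p(2)[of "(s - h, y)"] d(2)[OF h(1,2)] by (simp add: F_def sy)
qed

text \<open>Positive \<sigma>_1, the trace, excludes an interior maximum: there the Hessian is at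
  most the zero matrix, whose \<sigma>_1 is 0.\<close>

lemma subharmonic_negative:
  fixes D :: "(real ^ 'n) set"
  assumes D: "open D" "bounded D" and cf: "continuous_on (closure D) f"
    and bd: "\<And>x. x \<in> frontier D \<Longrightarrow> f x \<le> 0"
    and pos: "\<And>x. x \<in> D \<Longrightarrow> \<exists>H. has_hessian f H x \<and> 0 < elem_sym 1 (eigenvalues H)"
    and x: "x \<in> D"
  shows "f x < 0"
proof (rule ccontr)
  assume nn: "\<not> f x < 0"
  have xc: "x \<in> closure D" using x closure_subset by blast
  moreover have "compact (closure D)" using D by simp
  ultimately obtain y where y: "y \<in> closure D" "\<And>z. z \<in> closure D \<Longrightarrow> f z \<le> f y"
    using cf by (metis continuous_attains_sup empty_iff)
  \<comment> \<open>If the maximum over the closure is attained on the boundary, it is at most 0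
    \<le> f x, so x itself is an interior maximum.\<close>
  obtain m where m: "m \<in> D" "\<And>z. z \<in> D \<Longrightarrow> f z \<le> f m"
  proof (cases "y \<in> D")
    case True
    then show ?thesis using that y closure_subset by blast
  next
    case False
    then have "f y \<le> 0" using y(1) D(1) bd by (simp add: frontier_def interior_open)
    then have "f z \<le> f x" if "z \<in> D" for z
      using y(2)[of z] that nn closure_subset[of D] by force
    then show ?thesis using that x by blast
  qed
  obtain H where H: "has_hessian f H m" "0 < elem_sym 1 (eigenvalues H)" using pos m(1) by blast
  have "\<forall>\<^sub>F z in nhds m. f z \<le> f m"
    using eventually_nhds_in_open[OF D(1) m(1)] by eventually_elim (rule m(2))
  then have "v \<bullet> (H *v v) \<le> v \<bullet> (0 *v v)" for v
    using has_hessian_local_max[OF H(1)] by simp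
  moreover have tr0: "transpose (0 :: real ^ 'n ^ 'n) = 0" by (simp add: transpose_def vec_eq_iff)
  ultimately have "elem_sym 1 (eigenvalues H) \<le> elem_sym 1 (eigenvalues (0 :: real ^ 'n ^ 'n))"
    using H(2) by (intro elem_sym_eigenvalues_mono has_hessian_symmetric[OF H(1)]) auto
  also have "\<dots> = 0"
    using elem_sym_eigenvalues_conformal[OF tr0 orthogonal_matrix_id, of 1 0] by simp
  finally show False using H(2) by simp
qed

text \<open>The stationary problem with relational Hessians, a form in which dilated and rotated
  copies of \<open>\<theta>\<close> qualify directly.\<close>

definition profile :: "nat \<Rightarrow> (real ^ 'n) set \<Rightarrow> (real ^ 'n \<Rightarrow> real) \<Rightarrow> bool" where
  "profile k D \<theta> \<longleftrightarrow> continuous_on (closure D) \<theta> \<and> (\<forall>x\<in>frontier D. \<theta> x = 0)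
     \<and> (\<forall>x\<in>D. \<theta> x < 0 \<and> (\<exists>H. has_hessian \<theta> H x
          \<and> (\<forall>j\<in>{1..k}. 0 < elem_sym j (eigenvalues H))
          \<and> elem_sym k (eigenvalues H) = - (1 / (real k - 1)) * \<theta> x))"

text \<open>The clause at time 0 yields negativity of the initial values, about which the equation,
  posed for t > 0, is silent.\<close>

definition evolves :: "nat \<Rightarrow> (real ^ 'n) set \<Rightarrow> (real \<Rightarrow> real ^ 'n \<Rightarrow> real) \<Rightarrow> bool" where
  "evolves k D u \<longleftrightarrow> continuous_on ({0..} \<times> closure D) (\<lambda>(t, x). u t x)
     \<and> (\<forall>t>0. \<forall>x\<in>D. parabolic_at k u t x)
     \<and> (\<forall>x\<in>D. \<exists>H. has_hessian (u 0) H x \<and> 0 < elem_sym 1 (eigenvalues H))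
     \<and> (\<forall>t\<ge>0. \<forall>x\<in>frontier D. u t x = 0)"

lemma continuous_on_slice:
  assumes "continuous_on ({0..} \<times> S) (\<lambda>(t, x). u t x)" "0 \<le> t"
  shows "continuous_on S (u t)"
proof -
  have "continuous_on S ((\<lambda>(t, x). u t x) \<circ> (\<lambda>x. (t, x)))"
    using assms by (intro continuous_on_compose continuous_intros) (auto elim: continuous_on_subset)
  then show ?thesis by (simp add: o_def)
qed

lemma profile_nonpos:
  assumes "open D" "profile k D \<theta>" "x \<in> closure D"
  shows "\<theta> x \<le> 0"
  using assms by (cases "x \<in> D") (auto simp: profile_def frontier_def interior_open less_imp_le)

lemma evolves_negative:
  fixes D :: "(real ^ 'n) set"
  assumes D: "open D" "bounded D" and u: "evolves k D u" and k: "1 \<le> k"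
    and "0 \<le> t" "x \<in> D"
  shows "u t x < 0"
proof (rule subharmonic_negative[OF D])
  show "continuous_on (closure D) (u t)"
    using u \<open>0 \<le> t\<close> by (auto simp: evolves_def intro: continuous_on_slice)
  show "u t y \<le> 0" if "y \<in> frontier D" for y using u \<open>0 \<le> t\<close> that by (simp add: evolves_def)
  show "\<exists>H. has_hessian (u t) H y \<and> 0 < elem_sym 1 (eigenvalues H)" if "y \<in> D" for y
  proof (cases "t = 0")
    case False
    then have "parabolic_at k u t y" using u \<open>0 \<le> t\<close> that by (simp add: evolves_def)
    then show ?thesis using k unfolding parabolic_at_def by force
  qed (use u that in \<open>auto simp: evolves_def\<close>)
qed (use assms in auto)

text \<open>The profile equation is exactly what makes \<open>(T + t)\<^bsup>-1/(k-1)\<^esup> \<theta>\<close> a solution: with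
  \<open>a = 1/(k-1)\<close>, homogeneity of degree \<open>k\<close> turns the power \<open>-a\<close> into \<open>-a k = -a - 1\<close>.\<close>

lemma parabolic_at_self_similar:
  fixes \<theta> :: "real ^ 'n \<Rightarrow> real"
  assumes k: "2 \<le> k" and \<theta>: "profile k D \<theta>" and x: "x \<in> D" and T: "0 < T + t"
  shows "parabolic_at k (\<lambda>t x. (T + t) powr (- (1 / (real k - 1))) * \<theta> x + b) t x"
proof -
  obtain H where H: "has_hessian \<theta> H x" "\<forall>j\<in>{1..k}. 0 < elem_sym j (eigenvalues H)"
    "elem_sym k (eigenvalues H) = - (1 / (real k - 1)) * \<theta> x"
    using \<theta> x unfolding profile_def by blast
  define a where "a = 1 / (real k - 1)"
  define c where "c = (T + t) powr (- a)"
  have c: "c > 0" using T by (simp add: c_def)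
  have "has_hessian \<theta> H (0 + mat 1 *v (x - 0))" using H(1) by simp
  from has_hessian_affine[OF this, of c b]
  have 1: "has_hessian (\<lambda>x. c * \<theta> x + b) (c *\<^sub>R H) x" by simp
  have es: "elem_sym j (eigenvalues (c *\<^sub>R H)) = c ^ j * elem_sym j (eigenvalues H)" for j
    using elem_sym_eigenvalues_conformal[OF has_hessian_symmetric[OF H(1)] orthogonal_matrix_id, of j c] by simp
  have "- a * real k = - a - 1" using k by (simp add: a_def field_simps)
  then have ck: "c ^ k = (T + t) powr (- a - 1)"
    unfolding c_def using T by (simp add: powr_powr flip: powr_realpow)
  have "((\<lambda>t. (T + t) powr (- a) * \<theta> x + b) has_real_derivative
      (- a) * (T + t) powr (- a - 1) * \<theta> x) (at t)"
    using T by (auto intro!: derivative_eq_intros simp: powr_diff)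
  moreover have "(- a) * (T + t) powr (- a - 1) * \<theta> x = elem_sym k (eigenvalues (c *\<^sub>R H))"
    unfolding es ck H(3) a_def by simp
  ultimately show ?thesis
    unfolding parabolic_at_def a_def[symmetric]
    using 1 H(2) es c by (intro exI[of _ "c *\<^sub>R H"]) (auto simp: c_def)
qed

lemma continuous_on_self_similar:
  assumes "continuous_on S \<theta>" "0 < T"
  shows "continuous_on ({0..} \<times> S) (\<lambda>(t, x). (T + t) powr a * \<theta> x + b :: real)"
  unfolding case_prod_unfold using assms
  by (intro continuous_intros continuous_on_compose2[OF assms(1)]) auto

text \<open>C bounds the continuous quotient g / f, and multiplying by f < 0 reverses the
  inequality. Both time shifts T below are computed from such a C.\<close>

lemma exists_multiple_le:
  fixes f g :: "'a::topological_space \<Rightarrow> real"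
  assumes K: "compact K" and f: "continuous_on K f" and g: "continuous_on K g"
    and neg: "\<And>x. x \<in> K \<Longrightarrow> f x < 0"
  shows "\<exists>C>0. \<forall>x\<in>K. C * f x \<le> g x"
proof -
  have "continuous_on K (\<lambda>x. g x / f x)"
    using f g neg by (intro continuous_intros) force+
  then have "bounded ((\<lambda>x. g x / f x) ` K)"
    using K compact_continuous_image compact_imp_bounded by blast
  then obtain C where C: "C > 0" "\<And>x. x \<in> K \<Longrightarrow> \<bar>g x / f x\<bar> \<le> C"
    unfolding bounded_pos by auto
  have "C * f x \<le> g x" if "x \<in> K" for x
    using abs_le_D1[OF C(2)[OF that]] neg[OF that] by (simp add: neg_divide_le_eq)
  then show ?thesis using C(1) by blast
qed

text \<open>The bound is universal: the initial values only enter through \<open>T\<close>, which disappears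
  because \<open>T \<mapsto> (T + t)\<^bsup>-1/(k-1)\<^esup> \<theta>\<close> increases. The shift by \<open>\<epsilon>\<close> takes care of a possibly steep
  slope of \<open>u 0\<close> at the boundary.\<close>

lemma evolves_lower_bound:
  fixes D :: "(real ^ 'n) set"
  assumes D: "open D" "bounded D" and k: "2 \<le> k" and u: "evolves k D u" and \<theta>: "profile k D \<theta>"
    and t: "0 < t" and x: "x \<in> closure D"
  shows "t powr (- (1 / (real k - 1))) * \<theta> x \<le> u t x"
proof -
  define a where "a = 1 / (real k - 1)"
  have a: "a > 0" using k by (simp add: a_def)
  have cu0: "continuous_on (closure D) (u 0)"
    using u by (auto simp: evolves_def intro: continuous_on_slice)
  have c\<theta>: "continuous_on (closure D) \<theta>" using \<theta> by (simp add: profile_def)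
  have "t powr (- a) * \<theta> x \<le> u t x + \<epsilon>" if \<epsilon>: "\<epsilon> > 0" for \<epsilon>
  proof -
    \<comment> \<open>K avoids the boundary, where \<open>u 0\<close> vanishes; off K the shifted
      initial comparison follows from \<open>\<theta> \<le> 0\<close>.\<close>
    define K where "K = {x \<in> closure D. u 0 x \<le> - \<epsilon>}"
    have "closed (closure D \<inter> u 0 -` {..- \<epsilon>})"
      using cu0 by (intro continuous_closed_preimage) auto
    moreover have "closure D \<inter> u 0 -` {..- \<epsilon>} = K" by (auto simp: K_def)
    ultimately have "closed K" by simp
    then have K: "compact K" using D(2) by (auto simp: K_def compact_eq_bounded_closed intro: bounded_subset[of "closure D"])
    have KD: "x \<in> D" if "x \<in> K" for x
    proof (rule ccontr)
      assume "x \<notin> D"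
      then have "x \<in> frontier D" using that D(1) by (auto simp: K_def frontier_def interior_open)
      then have "u 0 x = 0" using u by (simp add: evolves_def)
      then show False using that \<epsilon> by (simp add: K_def)
    qed
    have "K \<subseteq> closure D" by (auto simp: K_def)
    then have "\<exists>C>0. \<forall>x\<in>K. C * \<theta> x \<le> u 0 x"
      using K KD \<theta> by (intro exists_multiple_le continuous_on_subset[OF cu0] continuous_on_subset[OF c\<theta>])
        (auto simp: profile_def)
    then obtain C where C: "C > 0" "\<And>x. x \<in> K \<Longrightarrow> C * \<theta> x \<le> u 0 x" by blast
    define T where "T = C powr (- (1 / a))"
    have T: "T > 0" "T powr (- a) = C" using C(1) a by (simp_all add: T_def powr_powr)
    have "(T + t) powr (- a) * \<theta> x + - \<epsilon> \<le> u t x"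
    proof (rule parabolic_comparison[OF D, where k = k and t = t])
      show "continuous_on ({0..} \<times> closure D) (\<lambda>(t, x). (T + t) powr (- a) * \<theta> x + - \<epsilon>)"
        using c\<theta> T(1) by (rule continuous_on_self_similar)
      show "continuous_on ({0..} \<times> closure D) (\<lambda>(t, x). u t x)" using u by (simp add: evolves_def)
      show "parabolic_at k (\<lambda>t x. (T + t) powr (- a) * \<theta> x + - \<epsilon>) s y" if "0 < s" "y \<in> D" for s y
        unfolding a_def using k \<theta> that T(1) by (intro parabolic_at_self_similar) auto
      show "parabolic_at k u s y" if "0 < s" "y \<in> D" for s y using u that by (simp add: evolves_def)
      show "(T + 0) powr (- a) * \<theta> y + - \<epsilon> \<le> u 0 y" if "y \<in> closure D" for y
      proof (cases "y \<in> K")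
        case True
        then show ?thesis using C(2)[OF True] T \<epsilon> by simp
      next
        case False
        then have "- \<epsilon> < u 0 y" using that by (simp add: K_def)
        moreover have "C * \<theta> y \<le> 0"
          using C(1) profile_nonpos[OF D(1) \<theta> that] by (simp add: mult_nonneg_nonpos)
        ultimately show ?thesis using T by simp
      qed
      show "(T + s) powr (- a) * \<theta> y + - \<epsilon> \<le> u s y" if "0 \<le> s" "y \<in> frontier D" for s y
        using that u \<theta> \<epsilon> by (simp add: evolves_def profile_def)
    qed (use t x in auto)
    moreover have "t powr (- a) * \<theta> x \<le> (T + t) powr (- a) * \<theta> x"
      using profile_nonpos[OF D(1) \<theta> x] T t a
      by (intro mult_right_mono_neg powr_mono2') auto
    ultimately show ?thesis by linarith
  qed
  then show ?thesis unfolding a_def[symmetric] by (rule field_le_epsilon)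
qed

text \<open>Compactness of \<open>closure E\<close> inside D keeps \<open>u 0\<close> away from 0,
  so one finite T serves. It depends on u and E, but its influence fades for large t.\<close>

lemma evolves_upper_bound:
  fixes D :: "(real ^ 'n) set"
  assumes D: "open D" "bounded D" and k: "2 \<le> k" and u: "evolves k D u"
    and E: "open E" "closure E \<subseteq> D" and \<psi>: "profile k E \<psi>"
  shows "\<exists>T>0. \<forall>t\<ge>0. \<forall>x\<in>closure E. u t x \<le> (T + t) powr (- (1 / (real k - 1))) * \<psi> x"
proof -
  define a where "a = 1 / (real k - 1)"
  have a: "a > 0" using k by (simp add: a_def)
  have ED: "E \<subseteq> D" using E(2) closure_subset by blast
  have bE: "bounded E" using D(2) ED bounded_subset by blast
  have cu: "continuous_on ({0..} \<times> closure E) (\<lambda>(t, x). u t x)"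
    using u E(2) closure_subset[of D] unfolding evolves_def
    by (auto elim!: continuous_on_subset)
  have cu0: "continuous_on (closure E) (u 0)"
    using cu by (rule continuous_on_slice) simp
  have c\<psi>: "continuous_on (closure E) \<psi>" using \<psi> by (simp add: profile_def)
  have neg: "u t x < 0" if "0 \<le> t" "x \<in> closure E" for t x
    using evolves_negative[OF D u _ that(1)] k E(2) that(2) by auto
  obtain C where C: "C > 0" "\<And>x. x \<in> closure E \<Longrightarrow> C * u 0 x \<le> \<psi> x"
    using exists_multiple_le[OF _ cu0 c\<psi>] neg bE by auto
  \<comment> \<open>Here the multiple is taken of \<open>u 0\<close>, so the self-similar solution
    starts from \<open>\<psi> / C\<close>; the lower bound starts from \<open>C \<theta>\<close>,
    hence the opposite sign in the exponent.\<close>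
  define T where "T = C powr (1 / a)"
  have T: "T > 0" "T powr (- a) = 1 / C" using C(1) a by (simp_all add: T_def powr_powr powr_minus_divide)
  have "u t x \<le> (T + t) powr (- a) * \<psi> x + 0" if "0 \<le> t" "x \<in> closure E" for t x
  proof (rule parabolic_comparison[OF E(1) bE cu, where k = k and t = t])
    show "continuous_on ({0..} \<times> closure E) (\<lambda>(t, x). (T + t) powr (- a) * \<psi> x + 0)"
      using c\<psi> T(1) by (rule continuous_on_self_similar)
    show "parabolic_at k (\<lambda>t x. (T + t) powr (- a) * \<psi> x + 0) s y" if "0 < s" "y \<in> E" for s y
      unfolding a_def using k \<psi> that T(1) by (intro parabolic_at_self_similar) auto
    show "parabolic_at k u s y" if "0 < s" "y \<in> E" for s y
      using u that ED by (auto simp: evolves_def)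
    show "u 0 y \<le> (T + 0) powr (- a) * \<psi> y + 0" if "y \<in> closure E" for y
      using C(2)[OF that] C(1) by (simp add: T(2) pos_le_divide_eq mult.commute)
    show "u s y \<le> (T + s) powr (- a) * \<psi> y + 0" if "0 \<le> s" "y \<in> frontier E" for s y
      using neg[of s y] that \<psi> by (simp add: profile_def frontier_def less_imp_le)
  qed (use that in auto)
  then show ?thesis unfolding a_def[symmetric] using T(1) by auto
qed

text \<open>Rescaling the argument by \<open>1/s\<close> multiplies the operator by \<open>s\<^bsup>-2k\<^esup>\<close>, which is compensated
  by the factor \<open>s\<^bsup>2k/(k-1)\<^esup>\<close>.\<close>

lemma profile_dilate:
  fixes M :: "real ^ 'n ^ 'n"
  assumes k: "2 \<le> k" and \<theta>: "profile k (ball x0 r) \<theta>" and r: "0 < r"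
    and M: "orthogonal_matrix M" and s: "0 < s"
  shows "profile k (ball x0 (s * r))
    (\<lambda>x. s powr (2 * real k / (real k - 1)) * \<theta> (x0 + ((1 / s) *\<^sub>R M) *v (x - x0)))"
proof -
  define b where "b = 2 * real k / (real k - 1)"
  define c where "c = s powr b"
  have c: "c > 0" using s by (simp add: c_def)
  \<comment> \<open>Dilation and rotation in one map: s < 1 serves the upper bound, and s = 1 with
    general M serves radial symmetry.\<close>
  define N where "N = (1 / s) *\<^sub>R M"
  have nrm: "norm (N *v v) = norm v / s" for v
  proof -
    have "orthogonal_transformation ((*v) M)"
      using M by (simp add: orthogonal_transformation_matrix)
    then have "norm (M *v v) = norm v" by (simp add: orthogonal_transformation_norm)
    moreover have "N *v v = (1 / s) *\<^sub>R (M *v v)" by (simp add: N_def scaleR_matrix_vector_assoc)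
    ultimately show ?thesis using s by simp
  qed
  have dist: "dist x0 (x0 + N *v (x - x0)) = dist x0 x / s" for x
    using nrm[of "x - x0"] by (simp add: dist_norm norm_minus_commute)
  have in_ball: "x0 + N *v (x - x0) \<in> ball x0 r" if "x \<in> ball x0 (s * r)" for x
    using that s by (simp add: dist pos_divide_less_eq mult.commute)
  have in_cball: "x0 + N *v (x - x0) \<in> cball x0 r" if "x \<in> cball x0 (s * r)" for x
    using that s by (simp add: dist pos_divide_le_eq mult.commute)
  have in_sphere: "x0 + N *v (x - x0) \<in> sphere x0 r" if "x \<in> sphere x0 (s * r)" for x
    using that s by (simp add: dist)
  have sr: "s * r > 0" using s r by simp
  \<comment> \<open>The exponent b is the solution of (b - 2) k = b.\<close>
  have ck: "(c * (1 / s)\<^sup>2) ^ k = c"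
  proof -
    have "c * (1 / s)\<^sup>2 = s powr (b - 2)"
      using s by (simp only: c_def powr_diff power_divide powr_numeral) simp
    then have "(c * (1 / s)\<^sup>2) ^ k = s powr ((b - 2) * real k)"
      using s by (simp only: powr_powr powr_gt_zero flip: powr_realpow)
    also have "(b - 2) * real k = b"
    proof -
      have "b * (real k - 1) = 2 * real k" using k by (simp add: b_def)
      then show ?thesis by (simp add: left_diff_distrib right_diff_distrib)
    qed
    finally show ?thesis unfolding c_def .
  qed
  have "continuous_on (cball x0 (s * r)) (\<lambda>x. c * \<theta> (x0 + N *v (x - x0)))"
  proof -
    have "continuous_on (cball x0 r) \<theta>" using \<theta> r by (simp add: profile_def)
    moreover have "continuous_on (cball x0 (s * r)) (\<lambda>x. x0 + N *v (x - x0))"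
      by (intro continuous_on_add continuous_on_const continuous_on_diff continuous_on_id
          bounded_linear.continuous_on[OF matrix_vector_mul_bounded_linear])
    ultimately have "continuous_on (cball x0 (s * r)) (\<lambda>x. \<theta> (x0 + N *v (x - x0)))"
      by (rule continuous_on_compose2) (use in_cball in blast)
    then show ?thesis by (rule continuous_on_mult_left)
  qed
  moreover have "c * \<theta> (x0 + N *v (x - x0)) = 0" if "x \<in> sphere x0 (s * r)" for x
    using \<theta> in_sphere[OF that] r by (simp add: profile_def)
  moreover have "c * \<theta> (x0 + N *v (x - x0)) < 0 \<and> (\<exists>H. has_hessian (\<lambda>x. c * \<theta> (x0 + N *v (x - x0))) H x
      \<and> (\<forall>j\<in>{1..k}. 0 < elem_sym j (eigenvalues H))
      \<and> elem_sym k (eigenvalues H) = - (1 / (real k - 1)) * (c * \<theta> (x0 + N *v (x - x0))))"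
    if x: "x \<in> ball x0 (s * r)" for x
  proof -
    obtain H where H: "has_hessian \<theta> H (x0 + N *v (x - x0))"
      "\<forall>j\<in>{1..k}. 0 < elem_sym j (eigenvalues H)"
      "elem_sym k (eigenvalues H) = - (1 / (real k - 1)) * \<theta> (x0 + N *v (x - x0))"
      using \<theta> in_ball[OF x] unfolding profile_def by blast
    define G where "G = (c * (1 / s)\<^sup>2) *\<^sub>R (transpose M ** H ** M)"
    have "transpose N = (1 / s) *\<^sub>R transpose M" by (simp add: N_def transpose_def vec_eq_iff)
    then have "c *\<^sub>R (transpose N ** H ** N) = G"
      by (simp add: G_def N_def matrix_scalar_ac power2_eq_square flip: scalar_matrix_assoc)
    then have "has_hessian (\<lambda>x. c * \<theta> (x0 + N *v (x - x0))) G x"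
      using has_hessian_affine[OF H(1), of c 0] by simp
    moreover have es: "elem_sym j (eigenvalues G) = (c * (1 / s)\<^sup>2) ^ j * elem_sym j (eigenvalues H)" for j
      unfolding G_def by (rule elem_sym_eigenvalues_conformal[OF has_hessian_symmetric[OF H(1)] M])
    moreover have "c * (1 / s)\<^sup>2 > 0" using c s by simp
    moreover have "\<theta> (x0 + N *v (x - x0)) < 0" using \<theta> in_ball[OF x] by (simp add: profile_def)
    ultimately show ?thesis
      using H(2,3) c ck by (intro conjI exI[of _ G]) (auto simp: mult_pos_neg)
  qed
  ultimately show ?thesis
    unfolding profile_def N_def[symmetric] b_def[symmetric] c_def[symmetric]
    using sr by simp
qed

section \<open>Convergence to the profile\<close>

text \<open>For s near 1 the factor s^b and the displacement of the argument, at most r (1 - s),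
  each cost at most \<epsilon>/2. In the remaining collar, \<open>\<theta>\<close> is small by
  uniform continuity and its zero boundary values.\<close>

lemma profile_dilate_close:
  fixes \<theta> :: "real ^ 'n \<Rightarrow> real"
  assumes k: "2 \<le> k" and \<theta>: "profile k (ball x0 r) \<theta>" and r: "0 < r" and \<epsilon>: "0 < \<epsilon>"
  obtains s \<psi> where "0 < s" "s < 1" "profile k (ball x0 (s * r)) \<psi>"
    "\<And>x. x \<in> cball x0 (s * r) \<Longrightarrow> \<psi> x \<le> \<theta> x + \<epsilon>"
    "\<And>x. x \<in> cball x0 r - cball x0 (s * r) \<Longrightarrow> - \<epsilon> \<le> \<theta> x"
proof -
  define b where "b = 2 * real k / (real k - 1)"
  have c\<theta>: "continuous_on (cball x0 r) \<theta>" and bd\<theta>: "\<And>x. x \<in> sphere x0 r \<Longrightarrow> \<theta> x = 0"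
    using \<theta> r by (simp_all add: profile_def)
  have np: "\<theta> x \<le> 0" if "x \<in> cball x0 r" for x
    using profile_nonpos[OF _ \<theta>] that r by simp
  have "bounded (\<theta> ` cball x0 r)"
    using c\<theta> compact_continuous_image compact_imp_bounded compact_cball by blast
  then obtain M where M: "M > 0" "\<And>x. x \<in> cball x0 r \<Longrightarrow> \<bar>\<theta> x\<bar> \<le> M"
    unfolding bounded_pos by auto
  have "uniformly_continuous_on (cball x0 r) \<theta>"
    using c\<theta> compact_uniformly_continuous compact_cball by blast
  then obtain \<delta> where \<delta>: "\<delta> > 0"
    "\<And>x y. x \<in> cball x0 r \<Longrightarrow> y \<in> cball x0 r \<Longrightarrow> dist y x < \<delta> \<Longrightarrow> dist (\<theta> y) (\<theta> x) < \<epsilon> / 2"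
    unfolding uniformly_continuous_on_def using \<epsilon> by (metis half_gt_zero)
  have "((\<lambda>s. (1 - s powr b) * M) \<longlongrightarrow> (1 - 1 powr b) * M) (at_left 1)"
    by (intro tendsto_intros) auto
  then have "\<forall>\<^sub>F s in at_left 1. (1 - s powr b) * M < \<epsilon> / 2"
    using \<epsilon> by (intro order_tendstoD(2)) auto
  moreover have "((\<lambda>s. r * (1 - s)) \<longlongrightarrow> r * (1 - 1)) (at_left 1)"
    by (intro tendsto_intros)
  then have "\<forall>\<^sub>F s in at_left 1. r * (1 - s) < \<delta>"
    using \<delta>(1) by (intro order_tendstoD(2)) auto
  moreover have "\<forall>\<^sub>F s in at_left (1::real). 0 < s \<and> s < 1"
    using eventually_at_left_real[of 0 "1::real"] by (auto elim: eventually_mono)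
  ultimately have "\<forall>\<^sub>F s in at_left (1::real). (1 - s powr b) * M < \<epsilon> / 2 \<and> r * (1 - s) < \<delta> \<and> 0 < s \<and> s < 1"
    by eventually_elim auto
  then obtain s where s: "(1 - s powr b) * M < \<epsilon> / 2" "r * (1 - s) < \<delta>" "0 < s" "s < 1"
    using eventually_happens' trivial_limit_at_left_real by blast
  define \<psi> where "\<psi> x = s powr b * \<theta> (x0 + ((1 / s) *\<^sub>R mat 1) *v (x - x0))" for x
  have \<psi>: "profile k (ball x0 (s * r)) \<psi>"
    unfolding \<psi>_def b_def by (rule profile_dilate[OF k \<theta> r orthogonal_matrix_id s(3)])
  have \<psi>_eq: "\<psi> x = s powr b * \<theta> (x0 + (1 / s) *\<^sub>R (x - x0))" for x
    by (simp add: \<psi>_def flip: scaleR_matrix_vector_assoc)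
  have in1: "\<psi> x \<le> \<theta> x + \<epsilon>" if x: "x \<in> cball x0 (s * r)" for x
  proof -
    define y where "y = x0 + (1 / s) *\<^sub>R (x - x0)"
    have nx: "norm (x - x0) \<le> s * r" using x by (simp add: dist_norm norm_minus_commute)
    have y: "y \<in> cball x0 r"
      using nx s(3) by (simp add: y_def dist_norm pos_divide_le_eq mult.commute)
    have "s * r \<le> 1 * r" using s r by (intro mult_right_mono) auto
    then have xr: "x \<in> cball x0 r" using x by simp
    have "y - x = (1 / s - 1) *\<^sub>R (x - x0)" by (simp add: y_def algebra_simps)
    then have "dist y x = (1 / s - 1) * norm (x - x0)" using s by (simp add: dist_norm)
    also have "\<dots> \<le> (1 / s - 1) * (s * r)" using nx s by (intro mult_left_mono) auto
    also have "\<dots> = r * (1 - s)" using s by (simp add: field_simps)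
    finally have "dist (\<theta> y) (\<theta> x) < \<epsilon> / 2" using s(2) by (intro \<delta>(2)[OF xr y]) linarith
    then have "\<theta> y < \<theta> x + \<epsilon> / 2" unfolding dist_real_def by linarith
    moreover have "s powr b * \<theta> y \<le> \<theta> y + \<epsilon> / 2"
    proof -
      have "s powr b \<le> 1" using s k by (intro powr_le1) (auto simp: b_def)
      then have "(1 - s powr b) * (- \<theta> y) \<le> (1 - s powr b) * M"
        using M(2)[OF y] by (intro mult_left_mono) auto
      then show ?thesis using s(1) by (simp add: algebra_simps)
    qed
    ultimately show ?thesis unfolding \<psi>_eq y_def[symmetric] by linarith
  qed
  have out: "- \<epsilon> \<le> \<theta> x" if x: "x \<in> cball x0 r - cball x0 (s * r)" for x
  proof -
    \<comment> \<open>The radial projection of x to the sphere, where \<open>\<theta>\<close>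
      vanishes.\<close>
    define y where "y = x0 + (r / norm (x - x0)) *\<^sub>R (x - x0)"
    have nx: "s * r < norm (x - x0)" "norm (x - x0) \<le> r"
      using x by (auto simp: dist_norm norm_minus_commute)
    have "0 < s * r" using s r by simp
    then have n0: "norm (x - x0) > 0" using nx by linarith
    have y: "y \<in> sphere x0 r" using n0 r by (simp add: y_def dist_norm)
    have "y - x = (r / norm (x - x0) - 1) *\<^sub>R (x - x0)" by (simp add: y_def algebra_simps)
    then have "dist y x = \<bar>r / norm (x - x0) - 1\<bar> * norm (x - x0)" by (simp add: dist_norm)
    also have "\<dots> = (r / norm (x - x0) - 1) * norm (x - x0)"
      using nx n0 by (simp add: abs_if pos_divide_less_eq)
    also have "\<dots> = r - norm (x - x0)" using n0 by (simp add: left_diff_distrib)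
    also have "\<dots> < \<delta>" using nx s(2) by (simp add: algebra_simps)
    finally have "dist (\<theta> y) (\<theta> x) < \<epsilon> / 2" using x y by (intro \<delta>(2)) auto
    then show ?thesis using bd\<theta>[OF y] \<epsilon> by (simp add: dist_real_def)
  qed
  show ?thesis using that[OF s(3,4) \<psi> in1 out] .
qed

text \<open>The lower bound holds on the whole ball, the upper one on the smaller ball. Since s is
  fixed before t tends to infinity, N and T may depend on it.\<close>

lemma rescaled_convergence:
  fixes \<theta> :: "real ^ 'n \<Rightarrow> real"
  assumes k: "2 \<le> k" and r: "0 < r" and \<theta>: "profile k (ball x0 r) \<theta>" and u: "evolves k (ball x0 r) u"
  shows "uniform_limit (cball x0 r) (\<lambda>t x. (1 + t) powr (1 / (real k - 1)) * u t x) \<theta> at_top"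
proof (rule uniform_limitI)
  fix e :: real assume e: "e > 0"
  define a where "a = 1 / (real k - 1)"
  define \<epsilon> where "\<epsilon> = e / 3"
  have \<epsilon>: "\<epsilon> > 0" using e by (simp add: \<epsilon>_def)
  have c\<theta>: "continuous_on (cball x0 r) \<theta>" using \<theta> r by (simp add: profile_def)
  have "bounded (\<theta> ` cball x0 r)"
    using c\<theta> compact_continuous_image compact_imp_bounded compact_cball by blast
  then obtain M where M: "M > 0" "\<And>x. x \<in> cball x0 r \<Longrightarrow> \<bar>\<theta> x\<bar> \<le> M"
    unfolding bounded_pos by auto
  obtain s \<psi> where s: "0 < s" "s < 1" and \<psi>: "profile k (ball x0 (s * r)) \<psi>"
    and in1: "\<And>x. x \<in> cball x0 (s * r) \<Longrightarrow> \<psi> x \<le> \<theta> x + \<epsilon>"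
    and out: "\<And>x. x \<in> cball x0 r - cball x0 (s * r) \<Longrightarrow> - \<epsilon> \<le> \<theta> x"
    using profile_dilate_close[OF k \<theta> r \<epsilon>] by blast
  have sr: "0 < s * r" "s * r < r" using s r by simp_all
  have "continuous_on (cball x0 (s * r)) \<psi>" using \<psi> sr by (simp add: profile_def)
  then have "bounded (\<psi> ` cball x0 (s * r))"
    using compact_continuous_image compact_imp_bounded compact_cball by blast
  then obtain N where N: "N > 0" "\<And>x. x \<in> cball x0 (s * r) \<Longrightarrow> \<bar>\<psi> x\<bar> \<le> N"
    unfolding bounded_pos by auto
  obtain T where T: "T > 0"
    "\<And>t x. 0 \<le> t \<Longrightarrow> x \<in> cball x0 (s * r) \<Longrightarrow> u t x \<le> (T + t) powr (- a) * \<psi> x"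
    using evolves_upper_bound[OF _ _ k u _ _ \<psi>] sr r unfolding a_def by (auto simp: subset_eq)
  \<comment> \<open>Replacing 1 + t by c + t is asymptotically invisible; c = 0 serves the lower
    bound and c = T the upper one.\<close>
  have lim: "\<forall>\<^sub>F t in at_top. \<bar>(1 + t) powr a * (c + t) powr (- a) - 1\<bar> * L < \<epsilon>" if "L > 0" for c L
  proof -
    have "((\<lambda>t. (1 + t) powr a * (c + t) powr (- a)) \<longlongrightarrow> 1) at_top"
    proof -
      have "((\<lambda>t. (1 + t) / (c + t)) \<longlongrightarrow> 1) at_top" by real_asymp
      then have "((\<lambda>t. ((1 + t) / (c + t)) powr a) \<longlongrightarrow> 1 powr a) at_top"
        by (intro tendsto_powr tendsto_const) auto
      moreover have "\<forall>\<^sub>F t in at_top. ((1 + t) / (c + t)) powr a = (1 + t) powr a * (c + t) powr (- a)"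
        using eventually_gt_at_top[of "max 0 (- c)"]
        by eventually_elim (simp add: powr_divide powr_minus_divide)
      ultimately show ?thesis by (simp add: tendsto_cong)
    qed
    then have "((\<lambda>t. \<bar>(1 + t) powr a * (c + t) powr (- a) - 1\<bar> * L) \<longlongrightarrow> \<bar>1 - 1\<bar> * L) at_top"
      by (intro tendsto_intros)
    then show ?thesis using \<epsilon> by (intro order_tendstoD(2)) auto
  qed
  show "\<forall>\<^sub>F t in at_top. \<forall>x\<in>cball x0 r. dist ((1 + t) powr (1 / (real k - 1)) * u t x) (\<theta> x) < e"
    unfolding a_def[symmetric]
    using lim[OF M(1), of 0] lim[OF N(1), of T] eventually_gt_at_top[of 0]
  proof eventually_elim
    case (elim t)
    show ?case
    proof
      fix x assume x: "x \<in> cball x0 r"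
      define p where "p = (1 + t) powr a"
      have p: "p > 0" using elim by (simp add: p_def)
      have approx: "\<bar>q * y - y\<bar> < \<epsilon>" if "\<bar>q - 1\<bar> * L < \<epsilon>" "\<bar>y\<bar> \<le> L" for q y L :: real
      proof -
        have "\<bar>q * y - y\<bar> = \<bar>q - 1\<bar> * \<bar>y\<bar>"
          unfolding abs_mult[symmetric] by (simp add: left_diff_distrib)
        also have "\<dots> \<le> \<bar>q - 1\<bar> * L" using that(2) by (intro mult_left_mono) auto
        finally show ?thesis using that(1) by linarith
      qed
      have "t powr (- a) * \<theta> x \<le> u t x"
        using evolves_lower_bound[OF _ _ k u \<theta> elim(3)] x r unfolding a_def by simp
      then have "p * (t powr (- a) * \<theta> x) \<le> p * u t x" using p by (intro mult_left_mono) auto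
      moreover have "\<bar>(p * t powr (- a)) * \<theta> x - \<theta> x\<bar> < \<epsilon>"
        using elim(1) M(2)[OF x] unfolding p_def by (intro approx) auto
      ultimately have lower: "\<theta> x - \<epsilon> < p * u t x" by (simp add: mult.assoc)
      have upper: "p * u t x < \<theta> x + 3 * \<epsilon>"
      proof (cases "x \<in> cball x0 (s * r)")
        case True
        have "p * u t x \<le> p * ((T + t) powr (- a) * \<psi> x)"
          using T(2)[OF _ True, of t] elim(3) p by (intro mult_left_mono) auto
        moreover have "\<bar>(p * (T + t) powr (- a)) * \<psi> x - \<psi> x\<bar> < \<epsilon>"
          using elim(2) N(2)[OF True] unfolding p_def by (intro approx) auto
        ultimately show ?thesis using in1[OF True] \<epsilon> by (simp add: mult.assoc)
      next
        case False
        \<comment> \<open>In the collar the sign of u replaces the comparison function, as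
          \<open>\<theta>\<close> is at least -\<epsilon> there.\<close>
        have "u t x \<le> 0"
        proof (cases "x \<in> ball x0 r")
          case True
          then show ?thesis using evolves_negative[OF _ _ u, of t x] k elim(3) by simp
        next
          case False
          then have "x \<in> frontier (ball x0 r)" using x r by simp
          then show ?thesis using u elim(3) by (simp add: evolves_def)
        qed
        then have "p * u t x \<le> 0" using p by (simp add: mult_nonneg_nonpos)
        then show ?thesis using out[of x] x False \<epsilon> by auto
      qed
      show "dist ((1 + t) powr a * u t x) (\<theta> x) < e"
        using lower upper \<epsilon> unfolding p_def[symmetric] \<epsilon>_def by (simp add: dist_real_def abs_if)
    qed
  qed
qed

text \<open>A rotated profile starts a self-similar solution, whose rescaling is constant in time but also
  converges to \<open>\<theta>\<close>.\<close>

lemma profile_radial: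
  fixes \<theta> :: "real ^ 'n \<Rightarrow> real"
  assumes k: "2 \<le> k" and r: "0 < r" and \<theta>: "profile k (ball x0 r) \<theta>"
    and x: "x \<in> cball x0 r" and y: "norm (y - x0) = norm (x - x0)"
  shows "\<theta> x = \<theta> y"
proof -
  obtain f where f: "orthogonal_transformation f" "f (x - x0) = y - x0"
    using orthogonal_transformation_exists[of "x - x0" "y - x0"] y by metis
  define M where "M = matrix f"
  have M: "orthogonal_matrix M" and Mf: "M *v v = f v" for v
    using f(1) unfolding M_def by (auto simp: orthogonal_transformation_matrix)
  define \<theta>' where "\<theta>' = (\<lambda>z. \<theta> (x0 + M *v (z - x0)))"
  \<comment> \<open>Dilation factor 1 leaves the pure rotation.\<close>
  have \<theta>': "profile k (ball x0 r) \<theta>'"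
    using profile_dilate[OF k \<theta> r M, of 1] by (simp add: \<theta>'_def)
  define a where "a = 1 / (real k - 1)"
  define u where "u t z = (1 + t) powr (- a) * \<theta>' z" for t z
  have par: "parabolic_at k u t z" if "0 \<le> t" "z \<in> ball x0 r" for t z
    using parabolic_at_self_similar[OF k \<theta>' that(2), of 1 t 0] that(1) unfolding u_def a_def by simp
  have "evolves k (ball x0 r) u"
    unfolding evolves_def
  proof (intro conjI allI ballI impI)
    show "continuous_on ({0..} \<times> closure (ball x0 r)) (\<lambda>(t, x). u t x)"
      using continuous_on_self_similar[of "closure (ball x0 r)" \<theta>' 1 "- a" 0] \<theta>'
      by (simp add: profile_def u_def)
    show "parabolic_at k u t z" if "0 < t" "z \<in> ball x0 r" for t z using par that by simp
    show "\<exists>H. has_hessian (u 0) H z \<and> 0 < elem_sym 1 (eigenvalues H)" if "z \<in> ball x0 r" for z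
      using par[OF _ that, of 0] k unfolding parabolic_at_def by force
    show "u t z = 0" if "z \<in> frontier (ball x0 r)" for t z
      using \<theta>' that by (simp add: u_def profile_def)
  qed
  then have "uniform_limit (cball x0 r) (\<lambda>t x. (1 + t) powr a * u t x) \<theta> at_top"
    unfolding a_def by (rule rescaled_convergence[OF k r \<theta>])
  then have "((\<lambda>t. (1 + t) powr a * u t x) \<longlongrightarrow> \<theta> x) at_top"
    using x by (rule tendsto_uniform_limitI)
  moreover have "\<forall>\<^sub>F t in at_top. (1 + t) powr a * u t x = \<theta>' x"
    using eventually_gt_at_top[of 0] by eventually_elim (simp add: u_def powr_minus_divide)
  then have "((\<lambda>t. (1 + t) powr a * u t x) \<longlongrightarrow> \<theta>' x) at_top"
    by (rule tendsto_eventually)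
  ultimately have "\<theta> x = \<theta>' x" using tendsto_unique trivial_limit_at_top_linorder by blast
  then show ?thesis by (simp add: \<theta>'_def Mf f(2))
qed

section \<open>Passage from the given problems to profiles and evolutions\<close>

lemma solves_stationary_profile:
  assumes "open \<Omega>" "solves_stationary k \<Omega> \<theta>"
  shows "profile k \<Omega> \<theta>"
proof -
  have "\<exists>H. has_hessian \<theta> H x \<and> (\<forall>j\<in>{1..k}. 0 < elem_sym j (eigenvalues H))
      \<and> elem_sym k (eigenvalues H) = - (1 / (real k - 1)) * \<theta> x" if "x \<in> \<Omega>" for x
    using assms that C2_on_has_hessian[of \<theta> \<Omega> x]
    unfolding solves_stationary_def admissible0_def admissible_def hessian_op_def by blast
  then show ?thesis
    using assms(2) unfolding profile_def solves_stationary_def admissible0_def admissible_def by blast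
qed

lemma solves_evolution_evolves:
  assumes "open \<Omega>" "1 \<le> k" "solves_evolution k \<Omega> u"
  shows "evolves k \<Omega> u"
proof -
  have h: "has_hessian (u t) (hessian (u t) x) x
      \<and> (\<forall>j\<in>{1..k}. 0 < elem_sym j (eigenvalues (hessian (u t) x)))" if "0 \<le> t" "x \<in> \<Omega>" for t x
    using assms that C2_on_has_hessian[of "u t" \<Omega> x]
    unfolding solves_evolution_def admissible_def hessian_op_def by blast
  have "parabolic_at k u t x" if "0 < t" "x \<in> \<Omega>" for t x
    using h[of t x] that assms(3) unfolding parabolic_at_def solves_evolution_def hessian_op_def
    by (intro exI[of _ "hessian (u t) x"]) auto
  moreover have "\<exists>H. has_hessian (u 0) H x \<and> 0 < elem_sym 1 (eigenvalues H)" if "x \<in> \<Omega>" for x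
    using h[of 0 x] that assms(2) by force
  ultimately show ?thesis using assms(3) unfolding evolves_def solves_evolution_def by blast
qed

theorem theorem2p3:
  fixes k :: nat and x0 :: "real ^ 'n" and r :: real and \<Omega> :: "(real ^ 'n) set"
    and \<theta> :: "real ^ 'n \<Rightarrow> real" and u :: "real \<Rightarrow> real ^ 'n \<Rightarrow> real"
  assumes "CARD('n) \<ge> 2" and "2 \<le> k" and "k \<le> CARD('n)"
    and "r > 0" and "\<Omega> = ball x0 r"
    and "solves_stationary k \<Omega> \<theta>"
    and "solves_evolution k \<Omega> u"
  shows "\<exists>\<phi> :: real \<Rightarrow> real.
    (\<forall>x\<in>closure \<Omega>. \<theta> x = \<phi> (norm (x - x0))) \<and>
    uniform_limit (closure \<Omega>)
      (\<lambda>t x. \<bar>(1 + t) powr (1 / (real k - 1)) * u t x - \<phi> (norm (x - x0))\<bar>)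
      (\<lambda>_. 0) at_top"
proof -
  have cl: "closure \<Omega> = cball x0 r" using assms by simp
  have \<theta>: "profile k (ball x0 r) \<theta>" and u: "evolves k (ball x0 r) u"
    using assms solves_stationary_profile[of \<Omega> k \<theta>] solves_evolution_evolves[of \<Omega> k u] by auto
  \<comment> \<open>The values along one ray; \<open>undefined\<close> picks an arbitrary coordinate
    direction.\<close>
  define \<phi> where "\<phi> s = \<theta> (x0 + s *\<^sub>R axis undefined 1)" for s
  have rad: "\<theta> x = \<phi> (norm (x - x0))" if "x \<in> cball x0 r" for x
    unfolding \<phi>_def using assms(2,4) \<theta> that by (rule profile_radial) simp
  have "uniform_limit (cball x0 r) (\<lambda>t x. (1 + t) powr (1 / (real k - 1)) * u t x) \<theta> at_top"
    using assms(2,4) \<theta> u by (rule rescaled_convergence)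
  then have "uniform_limit (cball x0 r)
      (\<lambda>t x. \<bar>(1 + t) powr (1 / (real k - 1)) * u t x - \<phi> (norm (x - x0))\<bar>) (\<lambda>_. 0) at_top"
    unfolding uniform_limit_iff by (simp add: dist_real_def rad)
  then show ?thesis unfolding cl using rad by blast
qed

end
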